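(* Let $k$ be an algebraically closed field of characteristic zero, $R=k[x_1,\dots,x_n]$, $\mathbf{m}=\langle x_1,\dots,x_n\rangle$, and let $I$ be a proper monomial ideal of $R$ with $\dim_k(R/I)<\infty$. Let $M=R/I$, regarded as an $R$-module. Then: 1. $\mathfrak{R}(M)^\vee=I^\perp/(\mathbf{m}\circ I^\perp)$ is both a reduced and a coreduced quotient of $I^\perp$. 2. $\mathfrak{R}(M^\vee)=\mathfrak{R}(I^\perp)=k$, and $k$ is the only nonzero reduced submodule of $\Gamma$. 3. $\mathfrak{R}(I^\perp)^\vee\cong k$, and this is the only nonzero reduced quotient of $M$. 4. $\mathfrak{R}((I^\perp)^\vee)=\mathfrak{R}(M)$, and this is both a reduced and a coreduced submodule of $M$.
   Context: Let $\Gamma=k[X_1,\dots,X_n]$ be the $R$-module with the apolarity action, the $k$-bilinear action determined by $x^\alpha\circ X^\beta=\frac{\beta!}{(\beta-\alpha)!}X^{\beta-\alpha}$ if $\beta_j\ge\alpha_j$ for all $j$, and $0$ otherwise. For an ideal $I\subseteq R$, $I^\perp=\{\gamma\in\Gamma: I\circ\gamma=0\}$, and $(R/I)^\vee:=I^\perp$. For a finitely generated submodule $W\subseteq\Gamma$, $W^\perp=\{r\in R:r\circ W=0\}$ and $W^\vee:=R/W^\perp$. $\mathbf{m}\circ I^\perp$ is the submodule of $I^\perp$ generated by all $a\circ\gamma$ with $a\in\mathbf{m}$, $\gamma\in I^\perp$; the Macaulay (Matlis) dual $\mathfrak{R}(M)^\vee$ of the submodule $\mathfrak{R}(M)\subseteq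 M$ is the quotient $I^\perp/(\mathbf{m}\circ I^\perp)$. An $R$-module $N$ is reduced if for all $a\in R$, $m\in N$, $a^2m=0$ implies $am=0$; it is coreduced if $aN=a^2N$ for all $a\in R$. For an $R$-module $N$, $\mathfrak{R}(N)=\{m\in N:\text{for all }a\in R,\ a^2m=0\Rightarrow am=0\}$. In item 2, $k$ denotes the constants in $\Gamma$; in item 3, $k=R/\mathbf{m}$. *)

theory Defs
  imports
    "HOL-Algebra.Algebra"
    "HOL-Algebra.Algebraic_Closure_Type"
    "HOL-Library.Poly_Mapping"
begin

section \<open>Modules over a commutative ring\<close>

text \<open>In records of type \<^typ>\<open>('a, 'b) module\<close> the fields \<^const>\<open>monoid.mult\<close> and \<^const>\<open>monoid.one\<close> are
  inherited from rings and play no role in the module structure.\<close>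

definition regular_module :: "('a, 'm) ring_scheme \<Rightarrow> ('a, 'a) module" where
  "regular_module R = \<lparr>carrier = carrier R, monoid.mult = monoid.mult R, monoid.one = monoid.one R,
     ring.zero = ring.zero R, ring.add = ring.add R, module.smult = monoid.mult R\<rparr>"

definition quot_module :: "('a, 'b, 'm) module_scheme \<Rightarrow> 'b set \<Rightarrow> ('a, 'b set) module" where
  "quot_module M N = \<lparr>carrier = a_rcosets\<^bsub>M\<^esub> N, monoid.mult = undefined, monoid.one = undefined,
     ring.zero = N, ring.add = set_add M,
     module.smult = (\<lambda>a C. \<Union>x\<in>C. N +>\<^bsub>M\<^esub> (a \<odot>\<^bsub>M\<^esub> x))\<rparr>"

definition generated_submodule ::
    "('a, 'c) ring_scheme \<Rightarrow> ('a, 'b, 'm) module_scheme \<Rightarrow> 'b set \<Rightarrow> 'b set" where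
  "generated_submodule R M S = \<Inter>{N. submodule N R M \<and> S \<subseteq> N}"

definition module_isomorphic ::
    "('a, 'c) ring_scheme \<Rightarrow> ('a, 'b, 'm) module_scheme \<Rightarrow> ('a, 'd, 'n) module_scheme \<Rightarrow> bool" where
  "module_isomorphic R M N \<longleftrightarrow> (\<exists>h. bij_betw h (carrier M) (carrier N) \<and>
     (\<forall>x\<in>carrier M. \<forall>y\<in>carrier M. h (x \<oplus>\<^bsub>M\<^esub> y) = h x \<oplus>\<^bsub>N\<^esub> h y) \<and>
     (\<forall>a\<in>carrier R. \<forall>x\<in>carrier M. h (a \<odot>\<^bsub>M\<^esub> x) = a \<odot>\<^bsub>N\<^esub> h x))"

definition nonzero_module :: "('a, 'b, 'm) module_scheme \<Rightarrow> bool" where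
  "nonzero_module M \<longleftrightarrow> carrier M \<noteq> {\<zero>\<^bsub>M\<^esub>}"

definition reduced_module :: "('a, 'c) ring_scheme \<Rightarrow> ('a, 'b, 'm) module_scheme \<Rightarrow> bool" where
  "reduced_module R N \<longleftrightarrow> module R N \<and>
     (\<forall>a\<in>carrier R. \<forall>m\<in>carrier N. (a [^]\<^bsub>R\<^esub> (2::nat)) \<odot>\<^bsub>N\<^esub> m = \<zero>\<^bsub>N\<^esub> \<longrightarrow> a \<odot>\<^bsub>N\<^esub> m = \<zero>\<^bsub>N\<^esub>)"

definition coreduced_module :: "('a, 'c) ring_scheme \<Rightarrow> ('a, 'b, 'm) module_scheme \<Rightarrow> bool" where
  "coreduced_module R N \<longleftrightarrow> module R N \<and>
     (\<forall>a\<in>carrier R. (\<lambda>m. a \<odot>\<^bsub>N\<^esub> m) ` carrier N = (\<lambda>m. (a [^]\<^bsub>R\<^esub> (2::nat)) \<odot>\<^bsub>N\<^esub> m) ` carrier N)"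

text \<open>The subset \<open>\<RR>(N)\<close>; for a general module it need not be a submodule.\<close>

definition reduced_part :: "('a, 'c) ring_scheme \<Rightarrow> ('a, 'b, 'm) module_scheme \<Rightarrow> 'b set" where
  "reduced_part R N = {m \<in> carrier N. \<forall>a\<in>carrier R.
     (a [^]\<^bsub>R\<^esub> (2::nat)) \<odot>\<^bsub>N\<^esub> m = \<zero>\<^bsub>N\<^esub> \<longrightarrow> a \<odot>\<^bsub>N\<^esub> m = \<zero>\<^bsub>N\<^esub>}"


section \<open>Polynomials and the apolarity action\<close>

text \<open>Polynomials over \<open>'k\<close> in variables indexed by \<open>'n\<close>: an exponent vector is an
  element of \<open>'n \<Rightarrow>\<^sub>0 nat\<close>, and multiplication is convolution.\<close>

type_synonym ('n, 'k) mpoly = "('n \<Rightarrow>\<^sub>0 nat) \<Rightarrow>\<^sub>0 'k"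

abbreviation mpoly_ring :: "('n::finite, 'k::field_char_0) mpoly ring" where
  "mpoly_ring \<equiv> ring_of_type_algebra"

abbreviation monomial :: "('n::finite \<Rightarrow>\<^sub>0 nat) \<Rightarrow> ('n, 'k::field_char_0) mpoly" where
  "monomial \<alpha> \<equiv> Poly_Mapping.single \<alpha> 1"

abbreviation const_poly :: "'k::field_char_0 \<Rightarrow> ('n::finite, 'k) mpoly" where
  "const_poly c \<equiv> Poly_Mapping.single 0 c"

definition constants :: "('n::finite, 'k::field_char_0) mpoly set" where
  "constants = const_poly ` UNIV"

definition max_ideal :: "('n::finite, 'k::field_char_0) mpoly set" where
  "max_ideal = Idl\<^bsub>mpoly_ring\<^esub> {monomial (Poly_Mapping.single j 1) | j. True}"

definition monomial_ideal :: "('n::finite, 'k::field_char_0) mpoly set \<Rightarrow> bool" where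
  "monomial_ideal I \<longleftrightarrow> (\<exists>A. I = Idl\<^bsub>mpoly_ring\<^esub> (monomial ` A))"

text \<open>\<open>dim\<^sub>k (R/I) < \<infinity>\<close>, with \<open>k\<close> embedded in the ring \<open>R/I\<close> as the classes of constants.\<close>

definition finite_codim :: "('n::finite, 'k::field_char_0) mpoly set \<Rightarrow> bool" where
  "finite_codim I \<longleftrightarrow> ring.finite_dimension (mpoly_ring Quot I)
     ((\<lambda>c. I +>\<^bsub>mpoly_ring\<^esub> c) ` constants) (carrier (mpoly_ring Quot I))"

definition apolar_monomial ::
    "('n::finite \<Rightarrow>\<^sub>0 nat) \<Rightarrow> ('n \<Rightarrow>\<^sub>0 nat) \<Rightarrow> ('n, 'k::field_char_0) mpoly" where
  "apolar_monomial \<alpha> \<beta> =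
     (if \<forall>j. Poly_Mapping.lookup \<alpha> j \<le> Poly_Mapping.lookup \<beta> j
      then Poly_Mapping.single (\<beta> - \<alpha>)
        ((\<Prod>j\<in>UNIV. fact (Poly_Mapping.lookup \<beta> j)) /
         (\<Prod>j\<in>UNIV. fact (Poly_Mapping.lookup (\<beta> - \<alpha>) j)))
      else 0)"

definition apolar ::
    "('n::finite, 'k::field_char_0) mpoly \<Rightarrow> ('n, 'k) mpoly \<Rightarrow> ('n, 'k) mpoly" where
  "apolar r \<gamma> = (\<Sum>\<alpha>\<in>Poly_Mapping.keys r. \<Sum>\<beta>\<in>Poly_Mapping.keys \<gamma>.
     const_poly (Poly_Mapping.lookup r \<alpha> * Poly_Mapping.lookup \<gamma> \<beta>) * apolar_monomial \<alpha> \<beta>)"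

lemma apolar_monomials:
  "apolar (monomial \<alpha>) (monomial \<beta>) = (apolar_monomial \<alpha> \<beta> :: ('n::finite, 'k::field_char_0) mpoly)"
  by (simp add: apolar_def)

definition Gamma_module :: "(('n::finite, 'k::field_char_0) mpoly, ('n, 'k) mpoly) module" where
  "Gamma_module = \<lparr>carrier = UNIV, monoid.mult = (*), monoid.one = 1, ring.zero = 0, ring.add = (+),
     module.smult = apolar\<rparr>"


section \<open>Macaulay duality\<close>

definition ideal_perp :: "('n::finite, 'k::field_char_0) mpoly set \<Rightarrow> ('n, 'k) mpoly set" where
  "ideal_perp I = {\<gamma>. \<forall>r\<in>I. apolar r \<gamma> = 0}"

definition submodule_perp :: "('n::finite, 'k::field_char_0) mpoly set \<Rightarrow> ('n, 'k) mpoly set" where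
  "submodule_perp W = {r. \<forall>\<gamma>\<in>W. apolar r \<gamma> = 0}"

definition quotient_by :: "('n::finite, 'k::field_char_0) mpoly set \<Rightarrow>
    (('n, 'k) mpoly, ('n, 'k) mpoly set) module" where
  "quotient_by I = quot_module (regular_module mpoly_ring) I"

text \<open>\<open>(R/I)\<^sup>\<or> = I\<^sup>\<bottom>\<close> as a submodule of \<open>\<Gamma>\<close>.\<close>

definition dual_of_quotient :: "('n::finite, 'k::field_char_0) mpoly set \<Rightarrow>
    (('n, 'k) mpoly, ('n, 'k) mpoly) module" where
  "dual_of_quotient I = Gamma_module\<lparr>carrier := ideal_perp I\<rparr>"

text \<open>\<open>W\<^sup>\<or> = R/W\<^sup>\<bottom>\<close> for \<open>W \<subseteq> \<Gamma>\<close>.\<close>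

definition dual_of_submodule :: "('n::finite, 'k::field_char_0) mpoly set \<Rightarrow>
    (('n, 'k) mpoly, ('n, 'k) mpoly set) module" where
  "dual_of_submodule W = quotient_by (submodule_perp W)"

text \<open>For a submodule \<open>S\<close> of \<open>R/I\<close>, the inclusion dualises to a surjection
  \<open>I\<^sup>\<bottom> = (R/I)\<^sup>\<or> \<rightarrow> S\<^sup>\<or>\<close> whose kernel consists of the \<open>\<gamma>\<close> annihilated by \<open>S\<close>.\<close>

definition dual_of_quotient_submodule :: "('n::finite, 'k::field_char_0) mpoly set \<Rightarrow>
    ('n, 'k) mpoly set set \<Rightarrow> (('n, 'k) mpoly, ('n, 'k) mpoly set) module" where
  "dual_of_quotient_submodule I S = quot_module (dual_of_quotient I)
     {\<gamma> \<in> ideal_perp I. \<forall>r. I +>\<^bsub>mpoly_ring\<^esub> r \<in> S \<longrightarrow> apolar r \<gamma> = 0}"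

text \<open>\<open>\<mm> \<circ> I\<^sup>\<bottom>\<close>\<close>

definition max_ideal_apolar_perp :: "('n::finite, 'k::field_char_0) mpoly set \<Rightarrow> ('n, 'k) mpoly set" where
  "max_ideal_apolar_perp I = generated_submodule mpoly_ring (dual_of_quotient I)
     {apolar a \<gamma> | a \<gamma>. a \<in> max_ideal \<and> \<gamma> \<in> ideal_perp I}"

end

theory Submission
  imports Defs
begin

text \<open>
  A module over the polynomial ring on which every \<open>x\<^sub>j\<close> is locally nilpotent has as reduced part
  exactly its socle, the elements killed by the maximal ideal \<open>\<mm>\<close>: from \<open>x\<^sub>j\<^sup>t m = 0\<close> one descends to
  \<open>x\<^sub>j m = 0\<close> by halving \<open>t\<close>, and conversely the polynomial ring acts on a module killed by \<open>\<mm>\<close>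
  through its residue field \<open>k\<close>, so such a module is reduced and coreduced. Nilpotency on \<open>\<Gamma>\<close> is
  clear by degree, and on \<open>R/I\<close> it follows from finite codimension. The duality statements are
  explicit for monomial ideals: \<open>I\<^sup>\<bottom>\<close> is spanned by the monomials \<open>X\<^sup>\<beta>\<close> with \<open>x\<^sup>\<beta> \<notin> I\<close>.
\<close>

section \<open>Quotient modules\<close>

text \<open>The duals are encoded concretely, so most of the duality becomes equality of sets. Item
  1 asks that the annihilator of the reduced part inside \<open>ideal_perp I\<close> be
  \<open>max_ideal_apolar_perp I\<close>. Item 3 asks that the annihilator of the constants be
  \<open>max_ideal\<close>, and item 4 that the double perp of \<open>I\<close> be \<open>I\<close>.
  The only isomorphism that has to be constructed is the one between R/I modulo the image of
  \<open>max_ideal\<close> and R/\<open>max_ideal\<close>. Monomiality allows membership in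
  \<open>I\<close> and in its perp to be tested one exponent at a time. Properness gives containment
  of \<open>I\<close> in \<open>max_ideal\<close>; this puts the constants into the perp and keeps
  the image of \<open>max_ideal\<close> in R/I proper. Characteristic zero keeps the factorials in
  the apolarity action invertible, so that a coefficient can be recovered from a derivative. The
  uniqueness claims hold because a reduced object here is killed by \<open>max_ideal\<close>, hence
  a vector space over k: inside Gamma it must sit in the line of constants, and as a quotient of R/I
  it is generated by the class of 1. In both cases its dimension is at most one.\<close>

lemma quot_module_simps:
  "carrier (quot_module M N) = a_rcosets\<^bsub>M\<^esub> N"
  "ring.zero (quot_module M N) = N"
  "ring.add (quot_module M N) = set_add M"
  by (simp_all add: quot_module_def)

lemma (in module) submodule_imp_abelian_subgroup:
  assumes "submodule N R M"
  shows "abelian_subgroup N M"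
  using assms by (intro abelian_subgroupI3 additive_subgroupI)
    (auto simp: submodule_def M.abelian_group_axioms)

lemma (in module) coset_eq_iff:
  assumes N: "submodule N R M" and x: "x \<in> carrier M" and y: "y \<in> carrier M"
  shows "N +>\<^bsub>M\<^esub> x = N +>\<^bsub>M\<^esub> y \<longleftrightarrow> x \<ominus>\<^bsub>M\<^esub> y \<in> N"
proof -
  interpret S: abelian_subgroup N M by (rule submodule_imp_abelian_subgroup[OF N])
  have sg: "subgroup N (add_monoid M)" using S.a_subgroup .
  show ?thesis
  proof
    assume "N +>\<^bsub>M\<^esub> x = N +>\<^bsub>M\<^esub> y"
    moreover have "x \<in> N +>\<^bsub>M\<^esub> x" using S.a_rcos_self[OF x] .
    ultimately have "x \<in> N +>\<^bsub>M\<^esub> y" by simp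
    then show "x \<ominus>\<^bsub>M\<^esub> y \<in> N" using S.a_rcos_module_imp[OF y] by (simp add: a_minus_def)
  next
    assume "x \<ominus>\<^bsub>M\<^esub> y \<in> N"
    then have "x \<in> N +>\<^bsub>M\<^esub> y" using S.a_rcos_module_rev[OF y x] by (simp add: a_minus_def)
    then show "N +>\<^bsub>M\<^esub> x = N +>\<^bsub>M\<^esub> y" using M.a_repr_independence[OF _ y sg] by simp
  qed
qed

lemma (in module) coset_eq_self_iff:
  assumes N: "submodule N R M" and x: "x \<in> carrier M"
  shows "N +>\<^bsub>M\<^esub> x = N \<longleftrightarrow> x \<in> N"
proof -
  interpret S: abelian_subgroup N M by (rule submodule_imp_abelian_subgroup[OF N])
  show ?thesis using S.a_subgroup M.a_coset_join1[OF _ x] M.a_coset_join2[OF x] by blast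
qed

lemma (in module) mem_coset_iff:
  assumes N: "submodule N R M" and x: "x \<in> carrier M"
  shows "y \<in> N +>\<^bsub>M\<^esub> x \<longleftrightarrow> y \<in> carrier M \<and> N +>\<^bsub>M\<^esub> y = N +>\<^bsub>M\<^esub> x"
proof -
  interpret S: abelian_subgroup N M by (rule submodule_imp_abelian_subgroup[OF N])
  show ?thesis
    using M.a_repr_independence[OF _ x S.a_subgroup, of y] S.a_rcos_self[of y]
      M.a_r_coset_subset_G[OF S.a_subset x] by blast
qed

lemma quot_module_carrierE:
  assumes "C \<in> carrier (quot_module M N)"
  obtains x where "x \<in> carrier M" "C = N +>\<^bsub>M\<^esub> x"
  using assms by (auto simp: quot_module_simps A_RCOSETS_def')

lemma (in module) quot_module_carrierI:
  "x \<in> carrier M \<Longrightarrow> N +>\<^bsub>M\<^esub> x \<in> carrier (quot_module M N)"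
  by (auto simp: quot_module_simps A_RCOSETS_def')

lemma (in module) quot_module_add:
  assumes N: "submodule N R M" and "x \<in> carrier M" "y \<in> carrier M"
  shows "(N +>\<^bsub>M\<^esub> x) \<oplus>\<^bsub>quot_module M N\<^esub> (N +>\<^bsub>M\<^esub> y) = N +>\<^bsub>M\<^esub> (x \<oplus>\<^bsub>M\<^esub> y)"
  using abelian_subgroup.a_rcos_sum[OF submodule_imp_abelian_subgroup[OF N]] assms
  by (simp add: quot_module_simps)

text \<open>Scalar multiplication of a coset is defined as a union over all its representatives. The
  union collapses because two representatives differ by an element of \<open>N\<close>, which stays
  in \<open>N\<close> after multiplication by \<open>a\<close>.\<close>

lemma (in module) quot_module_smult:
  assumes N: "submodule N R M" and a: "a \<in> carrier R" and x: "x \<in> carrier M"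
  shows "a \<odot>\<^bsub>quot_module M N\<^esub> (N +>\<^bsub>M\<^esub> x) = N +>\<^bsub>M\<^esub> (a \<odot>\<^bsub>M\<^esub> x)"
proof -
  interpret S: abelian_subgroup N M by (rule submodule_imp_abelian_subgroup[OF N])
  have "N +>\<^bsub>M\<^esub> (a \<odot>\<^bsub>M\<^esub> y) = N +>\<^bsub>M\<^esub> (a \<odot>\<^bsub>M\<^esub> x)" if "y \<in> N +>\<^bsub>M\<^esub> x" for y
  proof -
    have y: "y \<in> carrier M" and "y \<ominus>\<^bsub>M\<^esub> x \<in> N"
      using that coset_eq_iff[OF N _ x, of y] by (simp_all add: mem_coset_iff[OF N x])
    then have "a \<odot>\<^bsub>M\<^esub> (y \<ominus>\<^bsub>M\<^esub> x) \<in> N" using submoduleE(4)[OF N a] by simp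
    then have "a \<odot>\<^bsub>M\<^esub> y \<ominus>\<^bsub>M\<^esub> a \<odot>\<^bsub>M\<^esub> x \<in> N"
      using a x y by (simp add: a_minus_def smult_r_distr smult_r_minus)
    then show ?thesis using coset_eq_iff[OF N] a x y by simp
  qed
  moreover have "x \<in> N +>\<^bsub>M\<^esub> x" using S.a_rcos_self[OF x] .
  ultimately have "(\<Union>y\<in>N +>\<^bsub>M\<^esub> x. N +>\<^bsub>M\<^esub> (a \<odot>\<^bsub>M\<^esub> y)) = N +>\<^bsub>M\<^esub> (a \<odot>\<^bsub>M\<^esub> x)"
    by blast
  then show ?thesis by (simp add: quot_module_def)
qed

lemma (in module) module_quot_module:
  assumes N: "submodule N R M"
  shows "module R (quot_module M N)"
proof -
  interpret S: abelian_subgroup N M by (rule submodule_imp_abelian_subgroup[OF N])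
  have zero: "\<zero>\<^bsub>quot_module M N\<^esub> = N +>\<^bsub>M\<^esub> \<zero>\<^bsub>M\<^esub>"
    using coset_eq_self_iff[OF N, of "\<zero>\<^bsub>M\<^esub>"] by (simp add: quot_module_simps)
  note [simp] = quot_module_smult[OF N] quot_module_add[OF N] quot_module_carrierI
  have ab: "abelian_group (quot_module M N)"
  proof (rule abelian_groupI)
    fix C assume "C \<in> carrier (quot_module M N)"
    then obtain x where x: "x \<in> carrier M" "C = N +>\<^bsub>M\<^esub> x" by (rule quot_module_carrierE)
    then show "\<exists>D\<in>carrier (quot_module M N). D \<oplus>\<^bsub>quot_module M N\<^esub> C = \<zero>\<^bsub>quot_module M N\<^esub>"
      by (intro bexI[of _ "N +>\<^bsub>M\<^esub> (\<ominus>\<^bsub>M\<^esub> x)"]) (simp_all add: zero M.l_neg)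
  next
    fix C D assume "C \<in> carrier (quot_module M N)" "D \<in> carrier (quot_module M N)"
    then show "C \<oplus>\<^bsub>quot_module M N\<^esub> D = D \<oplus>\<^bsub>quot_module M N\<^esub> C"
      by (elim quot_module_carrierE) (simp add: M.a_comm)
  next
    fix C D E assume "C \<in> carrier (quot_module M N)" "D \<in> carrier (quot_module M N)"
      "E \<in> carrier (quot_module M N)"
    then show "(C \<oplus>\<^bsub>quot_module M N\<^esub> D) \<oplus>\<^bsub>quot_module M N\<^esub> E
      = C \<oplus>\<^bsub>quot_module M N\<^esub> (D \<oplus>\<^bsub>quot_module M N\<^esub> E)"
      by (elim quot_module_carrierE) (simp add: M.a_assoc)
  next
    show "\<zero>\<^bsub>quot_module M N\<^esub> \<in> carrier (quot_module M N)" unfolding zero by simp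
  next
    fix C assume "C \<in> carrier (quot_module M N)"
    then show "\<zero>\<^bsub>quot_module M N\<^esub> \<oplus>\<^bsub>quot_module M N\<^esub> C = C"
      unfolding zero by (elim quot_module_carrierE) simp
  qed (elim quot_module_carrierE, simp)
  show ?thesis
    by (rule moduleI[OF R.is_cring ab]; elim quot_module_carrierE)
      (simp_all add: smult_l_distr smult_r_distr smult_assoc1)
qed

lemma (in module) submodule_image_coset:
  assumes N: "submodule N R M" and P: "submodule P R M"
  shows "submodule ((\<lambda>x. N +>\<^bsub>M\<^esub> x) ` P) R (quot_module M N)"
proof -
  interpret Q: module R "quot_module M N" by (rule module_quot_module[OF N])
  note P' = submoduleE[OF P]
  have c: "x \<in> carrier M" if "x \<in> P" for x using that P' by blast
  have z: "\<zero>\<^bsub>quot_module M N\<^esub> = N +>\<^bsub>M\<^esub> \<zero>\<^bsub>M\<^esub>" and zP: "\<zero>\<^bsub>M\<^esub> \<in> P"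
    using coset_eq_self_iff[OF N, of "\<zero>\<^bsub>M\<^esub>"] submodule.axioms(1)[OF N] submodule.axioms(1)[OF P]
      subgroup.one_closed by (fastforce simp: quot_module_simps)+
  have neg: "\<ominus>\<^bsub>quot_module M N\<^esub> (N +>\<^bsub>M\<^esub> x) = N +>\<^bsub>M\<^esub> (\<ominus>\<^bsub>M\<^esub> x)" if "x \<in> carrier M" for x
    using that by (intro Q.M.minus_equality)
      (auto simp: quot_module_add[OF N] M.l_neg z intro!: quot_module_carrierI)
  show ?thesis
  proof (rule Q.submoduleI)
    show "(\<lambda>x. N +>\<^bsub>M\<^esub> x) ` P \<subseteq> carrier (quot_module M N)"
      using c quot_module_carrierI by blast
    show "\<zero>\<^bsub>quot_module M N\<^esub> \<in> (\<lambda>x. N +>\<^bsub>M\<^esub> x) ` P" using z zP by auto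
  qed (use P' c neg in \<open>auto simp: quot_module_add[OF N] quot_module_smult[OF N]\<close>)
qed

text \<open>An element of (M/N)/(P/N) is a set of cosets of \<open>N\<close>; flattening this set
  gives a coset of \<open>P\<close>. Thus \<open>Union\<close> is an explicit candidate for the map
  of the third isomorphism theorem.\<close>

lemma (in module) Union_quotient_coset:
  assumes N: "submodule N R M" and P: "submodule P R M" and NP: "N \<subseteq> P" and x: "x \<in> carrier M"
  shows "\<Union>(((\<lambda>p. N +>\<^bsub>M\<^esub> p) ` P) +>\<^bsub>quot_module M N\<^esub> (N +>\<^bsub>M\<^esub> x)) = P +>\<^bsub>M\<^esub> x"
proof -
  have c: "p \<in> carrier M" if "p \<in> P" for p using that submoduleE[OF P] by blast
  have "((\<lambda>p. N +>\<^bsub>M\<^esub> p) ` P) +>\<^bsub>quot_module M N\<^esub> (N +>\<^bsub>M\<^esub> x) = (\<lambda>p. N +>\<^bsub>M\<^esub> (p \<oplus>\<^bsub>M\<^esub> x)) ` P"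
    using c x by (auto simp: a_r_coset_def' quot_module_add[OF N, unfolded a_r_coset_def'])
  also have "\<Union>\<dots> = P +>\<^bsub>M\<^esub> x"
  proof (intro equalityI subsetI)
    fix y assume "y \<in> \<Union>((\<lambda>p. N +>\<^bsub>M\<^esub> (p \<oplus>\<^bsub>M\<^esub> x)) ` P)"
    then obtain p n where p: "p \<in> P" "n \<in> N" "y = n \<oplus>\<^bsub>M\<^esub> (p \<oplus>\<^bsub>M\<^esub> x)"
      by (auto simp: a_r_coset_def')
    then have "y = (n \<oplus>\<^bsub>M\<^esub> p) \<oplus>\<^bsub>M\<^esub> x" "n \<oplus>\<^bsub>M\<^esub> p \<in> P"
      using c NP x submoduleE(5)[OF P, of n p] by (auto simp: M.a_assoc subset_iff)
    then show "y \<in> P +>\<^bsub>M\<^esub> x" by (auto simp: a_r_coset_def')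
  next
    fix y assume "y \<in> P +>\<^bsub>M\<^esub> x"
    then obtain p where p: "p \<in> P" "y = p \<oplus>\<^bsub>M\<^esub> x" by (auto simp: a_r_coset_def')
    then have "y \<in> N +>\<^bsub>M\<^esub> (p \<oplus>\<^bsub>M\<^esub> x)" using c x by (auto simp: mem_coset_iff[OF N])
    then show "y \<in> \<Union>((\<lambda>p. N +>\<^bsub>M\<^esub> (p \<oplus>\<^bsub>M\<^esub> x)) ` P)" using p by blast
  qed
  finally show ?thesis .
qed

text \<open>Third isomorphism theorem, witnessed by \<open>Union\<close>. Well-definedness costs
  nothing, since the map acts on the sets themselves and not on chosen representatives.\<close>

lemma (in module) quotient_quotient_isomorphic:
  assumes N: "submodule N R M" and P: "submodule P R M" and NP: "N \<subseteq> P"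
  shows "module_isomorphic R (quot_module (quot_module M N) ((\<lambda>p. N +>\<^bsub>M\<^esub> p) ` P)) (quot_module M P)"
proof -
  let ?Q = "quot_module M N" and ?K = "(\<lambda>p. N +>\<^bsub>M\<^esub> p) ` P"
  let ?QQ = "quot_module ?Q ?K"
  interpret Q: module R ?Q by (rule module_quot_module[OF N])
  have K: "submodule ?K R ?Q" by (rule submodule_image_coset[OF N P])
  note U = Union_quotient_coset[OF N P NP]
  have QQE: "\<exists>x\<in>carrier M. C = ?K +>\<^bsub>?Q\<^esub> (N +>\<^bsub>M\<^esub> x)" if "C \<in> carrier ?QQ" for C
    using that by (metis quot_module_carrierE)
  have neg: "(N +>\<^bsub>M\<^esub> x) \<ominus>\<^bsub>?Q\<^esub> (N +>\<^bsub>M\<^esub> y) = N +>\<^bsub>M\<^esub> (x \<ominus>\<^bsub>M\<^esub> y)"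
    if "x \<in> carrier M" "y \<in> carrier M" for x y
  proof -
    have "(N +>\<^bsub>M\<^esub> (x \<ominus>\<^bsub>M\<^esub> y)) \<oplus>\<^bsub>?Q\<^esub> (N +>\<^bsub>M\<^esub> y) = N +>\<^bsub>M\<^esub> x"
      using that by (simp add: quot_module_add[OF N] a_minus_def M.a_assoc M.l_neg)
    then show ?thesis
      using Q.M.add.inv_solve_right[of "N +>\<^bsub>M\<^esub> (x \<ominus>\<^bsub>M\<^esub> y)" "N +>\<^bsub>M\<^esub> x" "N +>\<^bsub>M\<^esub> y"] that
      by (simp add: quot_module_carrierI a_minus_def)
  qed
  have inj: "inj_on \<Union> (carrier ?QQ)"
  proof (rule inj_onI)
    fix C D assume C: "C \<in> carrier ?QQ" and D: "D \<in> carrier ?QQ" and eq: "\<Union>C = \<Union>D"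
    obtain x where x: "x \<in> carrier M" "C = ?K +>\<^bsub>?Q\<^esub> (N +>\<^bsub>M\<^esub> x)" using QQE[OF C] by blast
    obtain y where y: "y \<in> carrier M" "D = ?K +>\<^bsub>?Q\<^esub> (N +>\<^bsub>M\<^esub> y)" using QQE[OF D] by blast
    have "P +>\<^bsub>M\<^esub> x = P +>\<^bsub>M\<^esub> y" using eq unfolding x(2) y(2) U[OF x(1)] U[OF y(1)] .
    then have "x \<ominus>\<^bsub>M\<^esub> y \<in> P" using coset_eq_iff[OF P x(1) y(1)] by simp
    then have "(N +>\<^bsub>M\<^esub> x) \<ominus>\<^bsub>?Q\<^esub> (N +>\<^bsub>M\<^esub> y) \<in> ?K" unfolding neg[OF x(1) y(1)] by (rule imageI)
    then show "C = D"
      using Q.coset_eq_iff[OF K quot_module_carrierI[OF x(1)] quot_module_carrierI[OF y(1)]]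
      unfolding x(2) y(2) by simp
  qed
  moreover have "\<Union> ` carrier ?QQ = carrier (quot_module M P)"
  proof (intro equalityI subsetI)
    fix A assume "A \<in> \<Union> ` carrier ?QQ"
    then obtain C where C: "C \<in> carrier ?QQ" "A = \<Union>C" by (rule imageE)
    obtain x where x: "x \<in> carrier M" "C = ?K +>\<^bsub>?Q\<^esub> (N +>\<^bsub>M\<^esub> x)" using QQE[OF C(1)] by blast
    show "A \<in> carrier (quot_module M P)"
      unfolding C(2) x(2) U[OF x(1)] by (rule quot_module_carrierI[OF x(1)])
  next
    fix A assume "A \<in> carrier (quot_module M P)"
    then obtain x where x: "x \<in> carrier M" "A = P +>\<^bsub>M\<^esub> x" by (rule quot_module_carrierE)
    show "A \<in> \<Union> ` carrier ?QQ"
      unfolding x(2) U[OF x(1), symmetric]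
      by (intro imageI Q.quot_module_carrierI quot_module_carrierI x(1))
  qed
  moreover have "\<Union>(C \<oplus>\<^bsub>?QQ\<^esub> D) = \<Union>C \<oplus>\<^bsub>quot_module M P\<^esub> \<Union>D"
    if C: "C \<in> carrier ?QQ" and D: "D \<in> carrier ?QQ" for C D
  proof -
    obtain x where x: "x \<in> carrier M" "C = ?K +>\<^bsub>?Q\<^esub> (N +>\<^bsub>M\<^esub> x)" using QQE[OF C] by blast
    obtain y where y: "y \<in> carrier M" "D = ?K +>\<^bsub>?Q\<^esub> (N +>\<^bsub>M\<^esub> y)" using QQE[OF D] by blast
    show ?thesis
      unfolding x(2) y(2) U[OF x(1)] U[OF y(1)] quot_module_add[OF P x(1) y(1)]
        Q.quot_module_add[OF K quot_module_carrierI[OF x(1)] quot_module_carrierI[OF y(1)]]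
        quot_module_add[OF N x(1) y(1)]
      by (rule U[OF M.a_closed[OF x(1) y(1)]])
  qed
  moreover have "\<Union>(a \<odot>\<^bsub>?QQ\<^esub> C) = a \<odot>\<^bsub>quot_module M P\<^esub> \<Union>C"
    if a: "a \<in> carrier R" and C: "C \<in> carrier ?QQ" for a C
  proof -
    obtain x where x: "x \<in> carrier M" "C = ?K +>\<^bsub>?Q\<^esub> (N +>\<^bsub>M\<^esub> x)" using QQE[OF C] by blast
    show ?thesis
      unfolding x(2) U[OF x(1)] quot_module_smult[OF P a x(1)]
        Q.quot_module_smult[OF K a quot_module_carrierI[OF x(1)]] quot_module_smult[OF N a x(1)]
      by (rule U[OF smult_closed[OF a x(1)]])
  qed
  ultimately show ?thesis
    unfolding module_isomorphic_def bij_betw_def by (intro exI[of _ Union] conjI ballI) simp_all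
qed

lemma module_isomorphic_refl: "module_isomorphic R M M"
  unfolding module_isomorphic_def by (rule exI[of _ id]) auto

section \<open>The reduced part: restriction to subsets and nilpotent scalars\<close>

lemma reduced_module_iff:
  "reduced_module R N \<longleftrightarrow> module R N \<and> reduced_part R N = carrier N"
  by (auto simp: reduced_module_def reduced_part_def)

lemma reduced_part_restrict:
  assumes "A \<subseteq> carrier N"
  shows "reduced_part R (N\<lparr>carrier := A\<rparr>) = A \<inter> reduced_part R N"
proof -
  have "reduced_part R (N\<lparr>carrier := A\<rparr>) = {m \<in> A. \<forall>a\<in>carrier R.
     (a [^]\<^bsub>R\<^esub> (2::nat)) \<odot>\<^bsub>N\<^esub> m = \<zero>\<^bsub>N\<^esub> \<longrightarrow> a \<odot>\<^bsub>N\<^esub> m = \<zero>\<^bsub>N\<^esub>}"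
    by (simp add: reduced_part_def)
  then show ?thesis unfolding reduced_part_def using assms by blast
qed

lemma (in module) reduced_part_nilpotent:
  assumes x: "x \<in> reduced_part R M" and a: "a \<in> carrier R"
    and "(a [^]\<^bsub>R\<^esub> (t::nat)) \<odot>\<^bsub>M\<^esub> x = \<zero>\<^bsub>M\<^esub>"
  shows "a \<odot>\<^bsub>M\<^esub> x = \<zero>\<^bsub>M\<^esub>"
  using assms(3)
proof (induction t rule: less_induct)
  case (less t)
  have xc: "x \<in> carrier M" using x by (simp add: reduced_part_def)
  show ?case
  proof (cases "t \<le> 1")
    case True
    then consider "t = 0" | "t = 1" by linarith
    then show ?thesis using less.prems a xc by cases auto
  next
    case False
    \<comment> \<open>Half of \<open>t\<close>, rounded up: \<open>2 * s\<close> is at least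
      \<open>t\<close>, so the square of \<open>a^s\<close> kills \<open>x\<close>, and
      \<open>s < t\<close> since \<open>t\<close> is at least 2. The defining property of the
      reduced part is then used for the scalar \<open>a^s\<close>, not for \<open>a\<close>.\<close>
    define s where "s = (t + 1) div 2"
    have s: "s < t" "2 * s = (2 * s - t) + t" using False by (auto simp: s_def)
    have "((a [^]\<^bsub>R\<^esub> s) [^]\<^bsub>R\<^esub> (2::nat)) \<odot>\<^bsub>M\<^esub> x = (a [^]\<^bsub>R\<^esub> (2 * s)) \<odot>\<^bsub>M\<^esub> x"
      using a by (simp add: R.nat_pow_pow mult.commute)
    also have "\<dots> = ((a [^]\<^bsub>R\<^esub> (2 * s - t)) \<otimes>\<^bsub>R\<^esub> (a [^]\<^bsub>R\<^esub> t)) \<odot>\<^bsub>M\<^esub> x"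
      using a s(2) by (simp only: R.nat_pow_mult)
    also have "\<dots> = \<zero>\<^bsub>M\<^esub>" using a xc less.prems by (simp add: smult_assoc1)
    finally have "(a [^]\<^bsub>R\<^esub> s) \<odot>\<^bsub>M\<^esub> x = \<zero>\<^bsub>M\<^esub>"
      using x a by (simp add: reduced_part_def)
    then show ?thesis using less.IH[OF s(1)] by simp
  qed
qed

section \<open>Modules over the polynomial ring\<close>

lemma mpoly_ring_simps [simp]:
  "carrier mpoly_ring = UNIV" "ring.zero mpoly_ring = 0" "monoid.one mpoly_ring = 1"
  "ring.add mpoly_ring = (+)" "monoid.mult mpoly_ring = (*)"
  by (simp_all add: ring_of_type_algebra_def)

lemma cring_mpoly_ring: "cring (mpoly_ring :: ('n::finite, 'k::field_char_0) mpoly ring)"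
  by (rule cring_from_type_algebra)

lemma mpoly_ring_pow [simp]:
  "(r :: ('n::finite, 'k::field_char_0) mpoly) [^]\<^bsub>mpoly_ring\<^esub> (t::nat) = r ^ t"
  by (induction t) (simp_all add: mult.commute)

lemma mpoly_ring_uminus [simp]:
  "\<ominus>\<^bsub>mpoly_ring\<^esub> (r :: ('n::finite, 'k::field_char_0) mpoly) = - r"
proof -
  interpret cring "mpoly_ring :: ('n, 'k) mpoly ring" by (rule cring_mpoly_ring)
  show ?thesis by (rule minus_equality) simp_all
qed

lemma regular_module_simps [simp]:
  "carrier (regular_module R) = carrier R" "ring.zero (regular_module R) = ring.zero R"
  "ring.add (regular_module R) = ring.add R" "module.smult (regular_module R) = monoid.mult R"
  by (simp_all add: regular_module_def)

lemma module_regular_module: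
  assumes "cring R" shows "module R (regular_module R)"
proof -
  interpret cring R by fact
  show ?thesis
    by (intro moduleI abelian_groupI assms)
      (auto simp: a_ac l_distr r_distr m_assoc intro: l_neg a_inv_closed)
qed

text \<open>Negation needs no clause of its own, being multiplication by -1. Ideals are handled
  through this elementary description from here on.\<close>

lemma ideal_mpoly_iff:
  fixes J :: "('n::finite, 'k::field_char_0) mpoly set"
  shows "ideal J mpoly_ring \<longleftrightarrow>
    0 \<in> J \<and> (\<forall>x\<in>J. \<forall>y\<in>J. x + y \<in> J) \<and> (\<forall>r. \<forall>x\<in>J. r * x \<in> J)"
proof -
  interpret R: cring "mpoly_ring :: ('n, 'k) mpoly ring" by (rule cring_mpoly_ring)
  show ?thesis
  proof
    assume "ideal J mpoly_ring"
    then interpret ideal J mpoly_ring .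
    show "0 \<in> J \<and> (\<forall>x\<in>J. \<forall>y\<in>J. x + y \<in> J) \<and> (\<forall>r. \<forall>x\<in>J. r * x \<in> J)"
      using a_closed I_l_closed zero_closed by simp
  next
    assume J: "0 \<in> J \<and> (\<forall>x\<in>J. \<forall>y\<in>J. x + y \<in> J) \<and> (\<forall>r. \<forall>x\<in>J. r * x \<in> J)"
    have "- x \<in> J" if "x \<in> J" for x using J that by (metis mult_minus1)
    then have "subgroup J (add_monoid mpoly_ring)"
      using J by (intro R.add.subgroupI) (auto simp flip: a_inv_def)
    then show "ideal J mpoly_ring"
      using J by (intro idealI R.ring_axioms) (simp_all, metis mult.commute)
  qed
qed

lemma submodule_regular_iff:
  fixes J :: "('n::finite, 'k::field_char_0) mpoly set"
  shows "submodule J mpoly_ring (regular_module mpoly_ring) \<longleftrightarrow> ideal J mpoly_ring"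
proof -
  interpret R: cring "mpoly_ring :: ('n, 'k) mpoly ring" by (rule cring_mpoly_ring)
  interpret M: module mpoly_ring "regular_module mpoly_ring :: (('n, 'k) mpoly, ('n, 'k) mpoly) module"
    by (rule module_regular_module) (rule cring_mpoly_ring)
  show ?thesis
  proof
    assume J: "submodule J mpoly_ring (regular_module mpoly_ring)"
    show "ideal J mpoly_ring"
      using M.submoduleE[OF J] subgroup.one_closed[OF submodule.axioms(1)[OF J]]
      by (simp add: ideal_mpoly_iff)
  next
    assume J: "ideal J mpoly_ring"
    have u: "\<ominus>\<^bsub>regular_module mpoly_ring\<^esub> x = - x" for x :: "('n, 'k) mpoly"
      by (rule M.minus_equality) simp_all
    have "- x \<in> J" if "x \<in> J" for x using J that by (metis mult_minus1 ideal_mpoly_iff)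
    then show "submodule J mpoly_ring (regular_module mpoly_ring)"
      using J by (intro M.submoduleI) (auto simp: ideal_mpoly_iff u)
  qed
qed

lemma mpoly_eq_sum_single:
  fixes r :: "'a \<Rightarrow>\<^sub>0 'b::comm_monoid_add"
  shows "r = (\<Sum>\<alpha>\<in>Poly_Mapping.keys r. Poly_Mapping.single \<alpha> (Poly_Mapping.lookup r \<alpha>))"
  by (rule poly_mapping_eqI)
    (auto simp: lookup_sum lookup_single when_def in_keys_iff)

text \<open>Every polynomial is a finite sum of single terms, so an identity additive in a
  polynomial has to be checked on single terms only.\<close>

lemma mpoly_induct [case_names zero add single]:
  fixes r :: "'a \<Rightarrow>\<^sub>0 'b::comm_monoid_add"
  assumes "P 0" and "\<And>p q. P p \<Longrightarrow> P q \<Longrightarrow> P (p + q)" and "\<And>\<alpha> c. P (Poly_Mapping.single \<alpha> c)"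
  shows "P r"
proof -
  have "P (\<Sum>\<alpha>\<in>A. Poly_Mapping.single \<alpha> (Poly_Mapping.lookup r \<alpha>))" if "finite A" for A
    using that by induction (auto intro: assms)
  then show ?thesis by (subst mpoly_eq_sum_single) simp
qed

lemma ideal_memI_singles:
  fixes J :: "('n::finite, 'k::field_char_0) mpoly set"
  assumes J: "ideal J mpoly_ring" and r: "\<And>\<alpha>. \<alpha> \<in> Poly_Mapping.keys r \<Longrightarrow> monomial \<alpha> \<in> J"
  shows "r \<in> J"
proof -
  have "(\<Sum>\<alpha>\<in>A. Poly_Mapping.single \<alpha> (Poly_Mapping.lookup r \<alpha>)) \<in> J"
    if "finite A" "A \<subseteq> Poly_Mapping.keys r" for A
    using that
  proof induction
    case (insert \<alpha> A)
    have "Poly_Mapping.single \<alpha> (Poly_Mapping.lookup r \<alpha>) = const_poly (Poly_Mapping.lookup r \<alpha>) * monomial \<alpha>"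
      by (simp add: mult_single)
    then show ?case using insert r J by (auto simp: ideal_mpoly_iff)
  qed (use J in \<open>simp add: ideal_mpoly_iff\<close>)
  then show ?thesis by (subst mpoly_eq_sum_single) simp
qed

section \<open>The constant term and the maximal ideal\<close>

lemma exponent_add_eq_0_iff:
  "(\<alpha> :: 'n \<Rightarrow>\<^sub>0 nat) + \<beta> = 0 \<longleftrightarrow> \<alpha> = 0 \<and> \<beta> = 0"
  by (auto simp: poly_mapping_eq_iff fun_eq_iff lookup_add)

text \<open>Evaluation at the origin is multiplicative, because natural exponents add up to 0 only
  if both are 0. This is the residue map from R to k in coefficient form.\<close>

lemma lookup_mult_0:
  fixes r s :: "('n \<Rightarrow>\<^sub>0 nat) \<Rightarrow>\<^sub>0 'k::semiring_0"
  shows "Poly_Mapping.lookup (r * s) 0 = Poly_Mapping.lookup r 0 * Poly_Mapping.lookup s 0"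
proof (induction r rule: mpoly_induct)
  case (add p q)
  then show ?case by (simp add: lookup_add distrib_right)
next
  case (single \<alpha> c)
  show ?case
    by (induction s rule: mpoly_induct)
      (auto simp: lookup_add distrib_left mult_single lookup_single when_def exponent_add_eq_0_iff)
qed simp

lemma max_ideal_ideal: "ideal max_ideal (mpoly_ring :: ('n::finite, 'k::field_char_0) mpoly ring)"
proof -
  interpret R: cring "mpoly_ring :: ('n, 'k) mpoly ring" by (rule cring_mpoly_ring)
  show ?thesis unfolding max_ideal_def by (rule R.genideal_ideal) simp
qed

lemma max_ideal_subset:
  fixes J :: "('n::finite, 'k::field_char_0) mpoly set"
  assumes "ideal J mpoly_ring" and "\<And>j. monomial (Poly_Mapping.single j 1) \<in> J"
  shows "max_ideal \<subseteq> J"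
proof -
  interpret R: cring "mpoly_ring :: ('n, 'k) mpoly ring" by (rule cring_mpoly_ring)
  show ?thesis unfolding max_ideal_def
    by (rule R.genideal_minimal) (use assms in auto)
qed

lemma variable_in_max_ideal:
  "monomial (Poly_Mapping.single j 1) \<in> (max_ideal :: ('n::finite, 'k::field_char_0) mpoly set)"
proof -
  interpret R: cring "mpoly_ring :: ('n, 'k) mpoly ring" by (rule cring_mpoly_ring)
  have "{monomial (Poly_Mapping.single j 1) | j. True} \<subseteq> (max_ideal :: ('n, 'k) mpoly set)"
    unfolding max_ideal_def by (rule R.genideal_self) simp
  then show ?thesis by blast
qed

text \<open>Subtraction of exponents truncates at 0, so the equation expresses that
  \<open>x_j\<close> divides the monomial with exponent \<open>\<alpha>\<close>.\<close>

lemma exponent_decompose: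
  fixes \<alpha> :: "'n \<Rightarrow>\<^sub>0 nat"
  assumes "\<alpha> \<noteq> 0"
  obtains j where "\<alpha> = (\<alpha> - Poly_Mapping.single j 1) + Poly_Mapping.single j 1"
proof -
  obtain j where "Poly_Mapping.lookup \<alpha> j \<noteq> 0"
    using assms by (auto simp: poly_mapping_eq_iff fun_eq_iff)
  then have "\<alpha> = (\<alpha> - Poly_Mapping.single j 1) + Poly_Mapping.single j 1"
    by (intro poly_mapping_eqI) (auto simp: lookup_add lookup_minus lookup_single when_def)
  then show ?thesis by (rule that)
qed

lemma single_exponent_neq_0: "Poly_Mapping.single j (Suc 0) \<noteq> 0"
  using lookup_single_eq[of j "Suc 0"] by (metis lookup_zero nat.distinct(1))

text \<open>The kernel of evaluation at the origin is an ideal containing the variables; conversely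
  each monomial other than 1 is divisible by a variable. Membership in a generated ideal thereby
  becomes a condition on one coefficient.\<close>

lemma max_ideal_iff:
  fixes r :: "('n::finite, 'k::field_char_0) mpoly"
  shows "r \<in> max_ideal \<longleftrightarrow> Poly_Mapping.lookup r 0 = 0"
proof
  have "(max_ideal :: ('n, 'k) mpoly set) \<subseteq> {r. Poly_Mapping.lookup r 0 = 0}"
    by (rule max_ideal_subset)
      (auto simp: ideal_mpoly_iff lookup_add lookup_mult_0 lookup_single when_def single_exponent_neq_0)
  then show "r \<in> max_ideal \<Longrightarrow> Poly_Mapping.lookup r 0 = 0" by blast
next
  assume r: "Poly_Mapping.lookup r 0 = 0"
  show "r \<in> max_ideal"
  proof (rule ideal_memI_singles[OF max_ideal_ideal])
    fix \<alpha> assume "\<alpha> \<in> Poly_Mapping.keys r"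
    then have "\<alpha> \<noteq> 0" using r by (auto simp: in_keys_iff)
    then obtain j where "\<alpha> = (\<alpha> - Poly_Mapping.single j 1) + Poly_Mapping.single j 1"
      by (rule exponent_decompose)
    then have "monomial \<alpha> = (monomial (\<alpha> - Poly_Mapping.single j 1) * monomial (Poly_Mapping.single j 1) :: ('n, 'k) mpoly)"
      by (simp add: mult_single)
    then show "monomial \<alpha> \<in> (max_ideal :: ('n, 'k) mpoly set)"
      using max_ideal_ideal variable_in_max_ideal[of j] unfolding ideal_mpoly_iff by metis
  qed
qed

lemma variable_power:
  "(monomial (Poly_Mapping.single j 1) :: ('n::finite, 'k::field_char_0) mpoly) ^ t
    = monomial (Poly_Mapping.single j t)"
  by (induction t) (simp_all add: mult_single flip: single_add)

section \<open>Modules killed by the maximal ideal, and the socle\<close>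

lemma annihilated_by_max_ideal_smult:
  fixes N :: "(('n::finite, 'k::field_char_0) mpoly, 'b, 'm) module_scheme"
  assumes N: "module mpoly_ring N" and x: "x \<in> carrier N"
    and m: "\<And>b. b \<in> max_ideal \<Longrightarrow> b \<odot>\<^bsub>N\<^esub> x = \<zero>\<^bsub>N\<^esub>"
    and ac: "Poly_Mapping.lookup a 0 = Poly_Mapping.lookup c 0"
  shows "a \<odot>\<^bsub>N\<^esub> x = c \<odot>\<^bsub>N\<^esub> x"
proof -
  interpret module mpoly_ring N by fact
  have "a \<odot>\<^bsub>N\<^esub> x = ((a - c) + c) \<odot>\<^bsub>N\<^esub> x" by simp
  also have "\<dots> = (a - c) \<odot>\<^bsub>N\<^esub> x \<oplus>\<^bsub>N\<^esub> c \<odot>\<^bsub>N\<^esub> x"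
    using smult_l_distr[of "a - c" c x] x by (simp del: diff_add_cancel)
  also have "(a - c) \<odot>\<^bsub>N\<^esub> x = \<zero>\<^bsub>N\<^esub>"
    by (rule m) (simp add: max_ideal_iff lookup_minus ac)
  finally show ?thesis using smult_closed[of c x] x by simp
qed

text \<open>Since the residue field is \<open>k\<close>, with \<open>e\<close> the inverse of the constant term of \<open>a\<close> (or \<open>0\<close>)
  the element \<open>a - a\<^sup>2e\<close> lies in the maximal ideal and thus acts as zero.\<close>

lemma annihilated_by_max_ideal_imp_reduced_coreduced:
  fixes N :: "(('n::finite, 'k::field_char_0) mpoly, 'b, 'm) module_scheme"
  assumes N: "module mpoly_ring N"
    and m: "\<And>b x. b \<in> max_ideal \<Longrightarrow> x \<in> carrier N \<Longrightarrow> b \<odot>\<^bsub>N\<^esub> x = \<zero>\<^bsub>N\<^esub>"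
  shows "reduced_module mpoly_ring N" and "coreduced_module mpoly_ring N"
proof -
  interpret module mpoly_ring N by fact
  \<comment> \<open>The two orders of the factors serve the two claims: with \<open>e\<close>
    outermost, \<open>a ^ 2\<close> killing \<open>x\<close> forces \<open>a\<close> to kill
    \<open>x\<close>; with \<open>a ^ 2\<close> outermost, the multiple of \<open>x\<close> by
    \<open>a\<close> is exhibited in the image of \<open>a ^ 2\<close>.\<close>
  have key: "\<exists>e. \<forall>x\<in>carrier N. a \<odot>\<^bsub>N\<^esub> x = a ^ 2 \<odot>\<^bsub>N\<^esub> (e \<odot>\<^bsub>N\<^esub> x) \<and> a \<odot>\<^bsub>N\<^esub> x = e \<odot>\<^bsub>N\<^esub> (a ^ 2 \<odot>\<^bsub>N\<^esub> x)"
    for a :: "('n, 'k) mpoly"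
  proof (intro exI ballI)
    fix x assume x: "x \<in> carrier N"
    define e :: "('n, 'k) mpoly" where "e = const_poly (inverse (Poly_Mapping.lookup a 0))"
    have "a \<odot>\<^bsub>N\<^esub> x = (a ^ 2 * e) \<odot>\<^bsub>N\<^esub> x"
      by (rule annihilated_by_max_ideal_smult[OF N x m[OF _ x]])
        (simp_all add: lookup_mult_0 e_def power2_eq_square field_simps)
    then show "a \<odot>\<^bsub>N\<^esub> x = a ^ 2 \<odot>\<^bsub>N\<^esub> (const_poly (inverse (Poly_Mapping.lookup a 0)) \<odot>\<^bsub>N\<^esub> x)
      \<and> a \<odot>\<^bsub>N\<^esub> x = const_poly (inverse (Poly_Mapping.lookup a 0)) \<odot>\<^bsub>N\<^esub> (a ^ 2 \<odot>\<^bsub>N\<^esub> x)"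
      using smult_assoc1[of "a ^ 2" e x] smult_assoc1[of e "a ^ 2" x] x
      by (simp add: mult.commute e_def)
  qed
  show "reduced_module mpoly_ring N"
    unfolding reduced_module_def
  proof (intro conjI ballI impI N)
    fix a x assume x: "x \<in> carrier N" and z: "a [^]\<^bsub>mpoly_ring\<^esub> (2::nat) \<odot>\<^bsub>N\<^esub> x = \<zero>\<^bsub>N\<^esub>"
    obtain e where "a \<odot>\<^bsub>N\<^esub> x = e \<odot>\<^bsub>N\<^esub> (a ^ 2 \<odot>\<^bsub>N\<^esub> x)" using key x by blast
    then show "a \<odot>\<^bsub>N\<^esub> x = \<zero>\<^bsub>N\<^esub>" using z smult_r_null[of e] by simp
  qed
  show "coreduced_module mpoly_ring N"
    unfolding coreduced_module_def
  proof (intro conjI ballI N equalityI subsetI)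
    fix a y assume "y \<in> (\<odot>\<^bsub>N\<^esub>) a ` carrier N"
    then obtain x where x: "x \<in> carrier N" "y = a \<odot>\<^bsub>N\<^esub> x" by blast
    obtain e where "a \<odot>\<^bsub>N\<^esub> x = a ^ 2 \<odot>\<^bsub>N\<^esub> (e \<odot>\<^bsub>N\<^esub> x)" using key x by blast
    then show "y \<in> (\<odot>\<^bsub>N\<^esub>) (a [^]\<^bsub>mpoly_ring\<^esub> (2::nat)) ` carrier N"
      using x smult_closed[of e x] by auto
  next
    fix a y assume "y \<in> (\<odot>\<^bsub>N\<^esub>) (a [^]\<^bsub>mpoly_ring\<^esub> (2::nat)) ` carrier N"
    then obtain x where x: "x \<in> carrier N" "y = a ^ 2 \<odot>\<^bsub>N\<^esub> x" by auto
    then have "y = a \<odot>\<^bsub>N\<^esub> (a \<odot>\<^bsub>N\<^esub> x)" using smult_assoc1[of a a x] by (simp add: power2_eq_square)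
    then show "y \<in> (\<odot>\<^bsub>N\<^esub>) a ` carrier N" using smult_closed[of a x] x by simp
  qed
qed

lemma ideal_annihilator:
  fixes N :: "(('n::finite, 'k::field_char_0) mpoly, 'b, 'm) module_scheme"
  assumes "module mpoly_ring N" and x: "x \<in> carrier N"
  shows "ideal {a. a \<odot>\<^bsub>N\<^esub> x = \<zero>\<^bsub>N\<^esub>} mpoly_ring"
proof -
  interpret module mpoly_ring N by fact
  show ?thesis
    unfolding ideal_mpoly_iff
    using x smult_l_null[OF x] smult_l_distr[of _ _ x] smult_assoc1[of _ _ x] smult_r_null
    by simp
qed

text \<open>The annihilator of \<open>x\<close> is an ideal, so it contains \<open>max_ideal\<close>
  as soon as it contains the variables. Nilpotency arguments speak about one variable at a time, and
  this assembles them.\<close>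

lemma annihilated_by_variables:
  fixes N :: "(('n::finite, 'k::field_char_0) mpoly, 'b, 'm) module_scheme"
  assumes "module mpoly_ring N" "x \<in> carrier N"
    and "\<And>j. monomial (Poly_Mapping.single j 1) \<odot>\<^bsub>N\<^esub> x = \<zero>\<^bsub>N\<^esub>" and "a \<in> max_ideal"
  shows "a \<odot>\<^bsub>N\<^esub> x = \<zero>\<^bsub>N\<^esub>"
  using max_ideal_subset[OF ideal_annihilator[OF assms(1,2)]] assms(3,4) by blast

definition socle ::
  "(('n::finite, 'k::field_char_0) mpoly, 'b, 'm) module_scheme \<Rightarrow> 'b set" where
  "socle N = {x \<in> carrier N. \<forall>a\<in>max_ideal. a \<odot>\<^bsub>N\<^esub> x = \<zero>\<^bsub>N\<^esub>}"

lemma socle_submodule: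
  fixes N :: "(('n::finite, 'k::field_char_0) mpoly, 'b, 'm) module_scheme"
  assumes "module mpoly_ring N"
  shows "submodule (socle N) mpoly_ring N"
proof -
  interpret module mpoly_ring N by fact
  have "a \<odot>\<^bsub>N\<^esub> (b \<odot>\<^bsub>N\<^esub> x) = b \<odot>\<^bsub>N\<^esub> (a \<odot>\<^bsub>N\<^esub> x)" if "x \<in> carrier N" for a b x
    using smult_assoc1[of a b x] smult_assoc1[of b a x] that by (simp add: mult.commute)
  then show ?thesis
    using smult_r_null smult_r_minus smult_r_distr smult_closed
    by (intro submoduleI) (auto simp: socle_def)
qed

lemma reduced_part_eq_socle:
  fixes N :: "(('n::finite, 'k::field_char_0) mpoly, 'b, 'm) module_scheme"
  assumes N: "module mpoly_ring N"
    and nil: "\<And>j x. x \<in> carrier N \<Longrightarrow> \<exists>t. monomial (Poly_Mapping.single j t) \<odot>\<^bsub>N\<^esub> x = \<zero>\<^bsub>N\<^esub>"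
  shows "reduced_part mpoly_ring N = socle N"
proof (intro equalityI subsetI)
  interpret module mpoly_ring N by fact
  fix x assume x: "x \<in> reduced_part mpoly_ring N"
  then have xc: "x \<in> carrier N" by (simp add: reduced_part_def)
  have "monomial (Poly_Mapping.single j 1) \<odot>\<^bsub>N\<^esub> x = \<zero>\<^bsub>N\<^esub>" for j
  proof -
    obtain t where "monomial (Poly_Mapping.single j t) \<odot>\<^bsub>N\<^esub> x = \<zero>\<^bsub>N\<^esub>" using nil[OF xc] by blast
    then show ?thesis
      using reduced_part_nilpotent[OF x, of "monomial (Poly_Mapping.single j 1)" t]
      by (simp only: mpoly_ring_pow variable_power mpoly_ring_simps UNIV_I simp_thms True_implies_equals)
  qed
  then show "x \<in> socle N"
    using annihilated_by_variables[OF N xc] xc by (simp add: socle_def)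
next
  have S: "module mpoly_ring (N\<lparr>carrier := socle N\<rparr>)"
    by (rule submodule.submodule_is_module[OF socle_submodule[OF N] N])
  \<comment> \<open>The socle is viewed as a module of its own, killed by \<open>max_ideal\<close>.
    Its reducedness carries over to \<open>N\<close> because restricting the carrier changes neither
    the action nor the zero.\<close>
  have red: "reduced_module mpoly_ring (N\<lparr>carrier := socle N\<rparr>)"
  proof (rule annihilated_by_max_ideal_imp_reduced_coreduced(1)[OF S])
    fix b x assume "b \<in> (max_ideal :: ('n, 'k) mpoly set)" "x \<in> carrier (N\<lparr>carrier := socle N\<rparr>)"
    then show "b \<odot>\<^bsub>N\<lparr>carrier := socle N\<rparr>\<^esub> x = \<zero>\<^bsub>N\<lparr>carrier := socle N\<rparr>\<^esub>"
      unfolding socle_def by simp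
  qed
  have sub: "socle N \<subseteq> carrier N" by (auto simp: socle_def)
  fix x assume "x \<in> socle N"
  then show "x \<in> reduced_part mpoly_ring N"
    using red reduced_part_restrict[OF sub, of mpoly_ring] by (auto simp: reduced_module_iff)
qed

section \<open>The apolarity module\<close>

lemma lookup_const_poly_mult:
  "Poly_Mapping.lookup (Poly_Mapping.single 0 c * p) \<delta> = c * Poly_Mapping.lookup p \<delta>"
  for p :: "('n \<Rightarrow>\<^sub>0 nat) \<Rightarrow>\<^sub>0 'k::semiring_0"
  by (induction p rule: mpoly_induct)
    (simp_all add: distrib_left lookup_add mult_single lookup_single when_def)

text \<open>The multi-index factorial \<open>\<beta>!\<close>, taken in the field, where
  characteristic zero makes it nonzero.\<close>

definition exponent_fact :: "('n::finite \<Rightarrow>\<^sub>0 nat) \<Rightarrow> 'k::field_char_0" where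
  "exponent_fact \<beta> = (\<Prod>j\<in>UNIV. fact (Poly_Mapping.lookup \<beta> j))"

lemma exponent_fact_neq_0 [simp]: "exponent_fact \<beta> \<noteq> 0"
  by (simp add: exponent_fact_def)

lemma lookup_apolar_monomial:
  "Poly_Mapping.lookup (apolar_monomial \<alpha> \<beta> :: ('n::finite, 'k::field_char_0) mpoly) \<delta> =
    (if \<beta> = \<alpha> + \<delta> then exponent_fact (\<alpha> + \<delta>) / exponent_fact \<delta> else 0)"
proof (cases "\<forall>j. Poly_Mapping.lookup \<alpha> j \<le> Poly_Mapping.lookup \<beta> j")
  case True
  then have "\<beta> - \<alpha> = \<delta> \<longleftrightarrow> \<beta> = \<alpha> + \<delta>"
    by (auto simp: poly_mapping_eq_iff fun_eq_iff lookup_add lookup_minus)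
      (metis add_diff_cancel_left' le_add_diff_inverse)+
  then show ?thesis
    using True by (auto simp: apolar_monomial_def lookup_single exponent_fact_def)
next
  case False
  then show ?thesis by (auto simp: apolar_monomial_def lookup_add)
qed

text \<open>Indexing by the exponent \<open>\<delta>\<close> of the result forces
  \<open>\<beta> = \<alpha> + \<delta>\<close>, so the double sum and the divisibility test
  disappear. The set \<open>A\<close> may exceed the support of \<open>r\<close>, so that sums for
  two different polynomials can share one index set.\<close>

lemma lookup_apolar:
  fixes r \<gamma> :: "('n::finite, 'k::field_char_0) mpoly"
  assumes "finite A" "Poly_Mapping.keys r \<subseteq> A"
  shows "Poly_Mapping.lookup (apolar r \<gamma>) \<delta> =
    (\<Sum>\<alpha>\<in>A. Poly_Mapping.lookup r \<alpha> * Poly_Mapping.lookup \<gamma> (\<alpha> + \<delta>) *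
      (exponent_fact (\<alpha> + \<delta>) / exponent_fact \<delta>))"
proof -
  have "Poly_Mapping.lookup (apolar r \<gamma>) \<delta> =
    (\<Sum>\<alpha>\<in>Poly_Mapping.keys r. \<Sum>\<beta>\<in>Poly_Mapping.keys \<gamma>. if \<beta> = \<alpha> + \<delta>
      then Poly_Mapping.lookup r \<alpha> * Poly_Mapping.lookup \<gamma> (\<alpha> + \<delta>) *
        (exponent_fact (\<alpha> + \<delta>) / exponent_fact \<delta>) else 0)"
    unfolding apolar_def lookup_sum lookup_const_poly_mult lookup_apolar_monomial
    by (intro sum.cong) auto
  also have "\<dots> = (\<Sum>\<alpha>\<in>Poly_Mapping.keys r. Poly_Mapping.lookup r \<alpha> *
      Poly_Mapping.lookup \<gamma> (\<alpha> + \<delta>) * (exponent_fact (\<alpha> + \<delta>) / exponent_fact \<delta>))"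
    by (intro sum.cong) (auto simp: in_keys_iff)
  also have "\<dots> = (\<Sum>\<alpha>\<in>A. Poly_Mapping.lookup r \<alpha> * Poly_Mapping.lookup \<gamma> (\<alpha> + \<delta>) *
      (exponent_fact (\<alpha> + \<delta>) / exponent_fact \<delta>))"
    using assms by (intro sum.mono_neutral_left) (auto simp: in_keys_iff)
  finally show ?thesis .
qed

lemma lookup_apolar_single:
  fixes \<gamma> :: "('n::finite, 'k::field_char_0) mpoly"
  shows "Poly_Mapping.lookup (apolar (Poly_Mapping.single \<alpha> c) \<gamma>) \<delta> =
    c * Poly_Mapping.lookup \<gamma> (\<alpha> + \<delta>) * (exponent_fact (\<alpha> + \<delta>) / exponent_fact \<delta>)"
  by (subst lookup_apolar[where A = "{\<alpha>}"]) auto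

lemma apolar_add_left:
  fixes r s \<gamma> :: "('n::finite, 'k::field_char_0) mpoly"
  shows "apolar (r + s) \<gamma> = apolar r \<gamma> + apolar s \<gamma>"
proof (rule poly_mapping_eqI)
  fix \<delta>
  let ?A = "Poly_Mapping.keys r \<union> Poly_Mapping.keys s"
  show "Poly_Mapping.lookup (apolar (r + s) \<gamma>) \<delta> = Poly_Mapping.lookup (apolar r \<gamma> + apolar s \<gamma>) \<delta>"
    using keys_add[of r s]
    by (simp add: lookup_add lookup_apolar[where A = ?A] distrib_right sum.distrib del: times_divide_eq_right)
qed

lemma apolar_add_right:
  fixes r \<gamma> \<gamma>' :: "('n::finite, 'k::field_char_0) mpoly"
  shows "apolar r (\<gamma> + \<gamma>') = apolar r \<gamma> + apolar r \<gamma>'"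
  by (rule poly_mapping_eqI)
    (simp add: lookup_add lookup_apolar[where A = "Poly_Mapping.keys r"] distrib_left distrib_right
      sum.distrib del: times_divide_eq_right)

lemma apolar_0_left [simp]: "apolar 0 \<gamma> = 0" and apolar_0_right [simp]: "apolar r 0 = 0"
  by (simp_all add: apolar_def)

text \<open>On single terms the factorial quotients telescope:
  (\<open>\<alpha>+\<beta>+\<delta>\<close>)!/(\<open>\<alpha>+\<delta>\<close>)! times
  (\<open>\<alpha>+\<delta>\<close>)!/\<open>\<delta>\<close>! is
  (\<open>\<alpha>+\<beta>+\<delta>\<close>)!/\<open>\<delta>\<close>!. Equivalently, each
  \<open>x_j\<close> acts as partial differentiation by \<open>X_j\<close>, and composing these
  operators corresponds to multiplying monomials.\<close>

lemma apolar_mult: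
  fixes r s \<gamma> :: "('n::finite, 'k::field_char_0) mpoly"
  shows "apolar (r * s) \<gamma> = apolar r (apolar s \<gamma>)"
proof (induction r rule: mpoly_induct)
  case (add p q)
  then show ?case by (simp add: distrib_right apolar_add_left)
next
  case (single \<alpha> c)
  show ?case
  proof (induction s rule: mpoly_induct)
    case (add p q)
    then show ?case by (simp add: distrib_left apolar_add_left apolar_add_right)
  next
    case (single \<beta> d)
    show ?case
      by (rule poly_mapping_eqI) (simp add: mult_single lookup_apolar_single ac_simps)
  qed simp
qed simp

lemma apolar_one [simp]: "apolar 1 \<gamma> = \<gamma>" for \<gamma> :: "('n::finite, 'k::field_char_0) mpoly"
  by (rule poly_mapping_eqI) (use lookup_apolar_single[of 0 1 \<gamma>] in simp)

text \<open>Every nonconstant monomial differentiates a constant to 0, so R acts on the constants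
  through its residue field.\<close>

lemma apolar_const_right:
  fixes r :: "('n::finite, 'k::field_char_0) mpoly"
  shows "apolar r (const_poly c) = const_poly (Poly_Mapping.lookup r 0 * c)"
proof (induction r rule: mpoly_induct)
  case (add p q)
  then show ?case by (simp add: apolar_add_left lookup_add distrib_right single_add)
next
  case (single \<alpha> d)
  show ?case
    by (rule poly_mapping_eqI)
      (auto simp: lookup_apolar_single lookup_single when_def exponent_add_eq_0_iff)
qed simp

lemma Gamma_module_simps [simp]:
  "carrier Gamma_module = UNIV" "ring.zero Gamma_module = 0"
  "ring.add Gamma_module = (+)" "module.smult Gamma_module = apolar"
  by (simp_all add: Gamma_module_def)

lemma module_Gamma: "module mpoly_ring (Gamma_module :: (('n::finite, 'k::field_char_0) mpoly, _) module)"
proof -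
  have "\<exists>y. y + x = 0" for x :: "('n, 'k) mpoly" by (rule exI[of _ "- x"]) simp
  then show ?thesis
    by (intro moduleI abelian_groupI cring_mpoly_ring)
      (auto simp: apolar_add_left apolar_add_right apolar_mult add_ac)
qed

lemma submodule_Gamma_iff:
  fixes N :: "('n::finite, 'k::field_char_0) mpoly set"
  shows "submodule N mpoly_ring Gamma_module \<longleftrightarrow>
    0 \<in> N \<and> (\<forall>x\<in>N. \<forall>y\<in>N. x + y \<in> N) \<and> (\<forall>r. \<forall>x\<in>N. apolar r x \<in> N)"
proof -
  interpret module mpoly_ring "Gamma_module :: (('n, 'k) mpoly, _) module" by (rule module_Gamma)
  show ?thesis
  proof
    assume N: "submodule N mpoly_ring Gamma_module"
    then show "0 \<in> N \<and> (\<forall>x\<in>N. \<forall>y\<in>N. x + y \<in> N) \<and> (\<forall>r. \<forall>x\<in>N. apolar r x \<in> N)"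
      using submoduleE[OF N] subgroup.one_closed[OF submodule.axioms(1)[OF N]] by simp
  next
    assume N: "0 \<in> N \<and> (\<forall>x\<in>N. \<forall>y\<in>N. x + y \<in> N) \<and> (\<forall>r. \<forall>x\<in>N. apolar r x \<in> N)"
    have "\<ominus>\<^bsub>Gamma_module\<^esub> x \<in> N" if "x \<in> N" for x
    proof -
      have "\<ominus>\<^bsub>Gamma_module\<^esub> x = apolar (- 1) x"
        by (rule M.minus_equality) (use apolar_add_left[of "- 1" 1 x] in simp_all)
      then show ?thesis using N that by simp
    qed
    then show "submodule N mpoly_ring Gamma_module"
      using N by (intro submoduleI) auto
  qed
qed

lemma apolar_nilpotent:
  fixes \<gamma> :: "('n::finite, 'k::field_char_0) mpoly"
  shows "\<exists>t. apolar (monomial (Poly_Mapping.single j t)) \<gamma> = 0"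
proof -
  obtain t where t: "\<forall>n\<in>(\<lambda>\<beta>. Poly_Mapping.lookup \<beta> j) ` Poly_Mapping.keys \<gamma>. n < t"
    using finite_nat_set_iff_bounded[of "(\<lambda>\<beta>. Poly_Mapping.lookup \<beta> j) ` Poly_Mapping.keys \<gamma>"] by auto
  have "Poly_Mapping.single j t + \<delta> \<notin> Poly_Mapping.keys \<gamma>" for \<delta>
    using t by (force simp: lookup_add)
  then have "apolar (monomial (Poly_Mapping.single j t)) \<gamma> = 0"
    by (intro poly_mapping_eqI) (simp add: lookup_apolar_single in_keys_iff)
  then show ?thesis ..
qed

text \<open>A polynomial with vanishing partial derivatives is constant: the factor relating a
  coefficient of \<open>\<gamma>\<close> at a nonzero exponent to a coefficient of a derivative is a
  quotient of factorials, which is nonzero in characteristic zero.\<close>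

lemma apolar_variables_eq_0_imp_constant:
  fixes \<gamma> :: "('n::finite, 'k::field_char_0) mpoly"
  assumes "\<And>j. apolar (monomial (Poly_Mapping.single j 1)) \<gamma> = 0"
  shows "\<gamma> \<in> constants"
proof -
  have "Poly_Mapping.lookup \<gamma> \<beta> = 0" if "\<beta> \<noteq> 0" for \<beta>
  proof -
    obtain j where \<beta>: "\<beta> = (\<beta> - Poly_Mapping.single j 1) + Poly_Mapping.single j 1"
      using \<open>\<beta> \<noteq> 0\<close> by (rule exponent_decompose)
    have "Poly_Mapping.lookup \<gamma> (Poly_Mapping.single j 1 + (\<beta> - Poly_Mapping.single j 1)) = 0"
      using assms[of j]
        lookup_apolar_single[of "Poly_Mapping.single j 1" 1 \<gamma> "\<beta> - Poly_Mapping.single j 1"]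
      by simp
    then show ?thesis using \<beta> by (metis add.commute)
  qed
  then have "\<gamma> = const_poly (Poly_Mapping.lookup \<gamma> 0)"
    by (intro poly_mapping_eqI) (auto simp: lookup_single when_def)
  then show ?thesis unfolding constants_def by blast
qed

lemma socle_Gamma: "socle Gamma_module = (constants :: ('n::finite, 'k::field_char_0) mpoly set)"
proof (intro equalityI subsetI)
  fix \<gamma> :: "('n, 'k) mpoly" assume "\<gamma> \<in> socle Gamma_module"
  then show "\<gamma> \<in> constants"
    by (intro apolar_variables_eq_0_imp_constant) (use variable_in_max_ideal in \<open>auto simp: socle_def\<close>)
next
  fix \<gamma> :: "('n, 'k) mpoly" assume "\<gamma> \<in> constants"
  then show "\<gamma> \<in> socle Gamma_module"
    by (auto simp: socle_def constants_def apolar_const_right max_ideal_iff)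
qed

lemma module_Gamma_submodule:
  fixes N :: "('n::finite, 'k::field_char_0) mpoly set"
  shows "submodule N mpoly_ring Gamma_module \<Longrightarrow> module mpoly_ring (Gamma_module\<lparr>carrier := N\<rparr>)"
  by (rule submodule.submodule_is_module[OF _ module_Gamma])

lemma reduced_part_Gamma_submodule:
  fixes N :: "('n::finite, 'k::field_char_0) mpoly set"
  assumes "submodule N mpoly_ring Gamma_module"
  shows "reduced_part mpoly_ring (Gamma_module\<lparr>carrier := N\<rparr>) = N \<inter> constants"
proof -
  have "reduced_part mpoly_ring (Gamma_module\<lparr>carrier := N\<rparr>) = socle (Gamma_module\<lparr>carrier := N\<rparr>)"
    by (rule reduced_part_eq_socle[OF module_Gamma_submodule[OF assms]]) (simp add: apolar_nilpotent)
  also have "\<dots> = N \<inter> constants" by (auto simp: socle_def simp flip: socle_Gamma)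
  finally show ?thesis .
qed

lemma constants_submodule:
  "submodule constants mpoly_ring (Gamma_module :: (('n::finite, 'k::field_char_0) mpoly, _) module)"
  using socle_submodule[OF module_Gamma] by (simp add: socle_Gamma)

text \<open>Reducedness confines \<open>N\<close> to the constants. A nonzero submodule then
  contains some constant \<open>c\<close> different from 0, and acting with the constants
  \<open>d / c\<close> produces all the others.\<close>

lemma reduced_submodules_Gamma:
  fixes N :: "('n::finite, 'k::field_char_0) mpoly set"
  shows "submodule N mpoly_ring Gamma_module \<and> nonzero_module (Gamma_module\<lparr>carrier := N\<rparr>) \<and>
     reduced_module mpoly_ring (Gamma_module\<lparr>carrier := N\<rparr>) \<longleftrightarrow> N = constants"
proof (intro iffI conjI; (elim conjE)?)
  assume N: "submodule N mpoly_ring Gamma_module" and nz: "nonzero_module (Gamma_module\<lparr>carrier := N\<rparr>)"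
    and red: "reduced_module mpoly_ring (Gamma_module\<lparr>carrier := N\<rparr>)"
  have sub: "N \<subseteq> constants"
    using red reduced_part_Gamma_submodule[OF N] by (auto simp: reduced_module_iff)
  obtain x where "x \<in> N" "x \<noteq> 0"
    using nz N by (auto simp: nonzero_module_def submodule_Gamma_iff)
  moreover from this obtain c where "x = const_poly c" using sub by (auto simp: constants_def)
  ultimately have c: "const_poly c \<in> N" "c \<noteq> 0" by auto
  have "const_poly d \<in> N" for d
  proof -
    have "const_poly d = apolar (const_poly (d / c)) (const_poly c :: ('n, 'k) mpoly)"
      using c by (simp add: apolar_const_right)
    then show ?thesis using N c by (simp add: submodule_Gamma_iff)
  qed
  then show "N = constants" using sub by (auto simp: constants_def)
next
  assume N: "N = constants"
  show "submodule N mpoly_ring Gamma_module" unfolding N by (rule constants_submodule)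
  have "1 \<in> N" by (auto simp: N constants_def simp flip: single_one)
  then show "nonzero_module (Gamma_module\<lparr>carrier := N\<rparr>)"
    by (auto simp: nonzero_module_def)
  show "reduced_module mpoly_ring (Gamma_module\<lparr>carrier := N\<rparr>)"
    using reduced_part_Gamma_submodule[OF constants_submodule] module_Gamma_submodule[OF constants_submodule]
    by (simp add: N reduced_module_iff)
qed

section \<open>Monomial ideals of finite codimension\<close>

lemma coset_regular_module [simp]: "(+>\<^bsub>regular_module R\<^esub>) = (+>\<^bsub>R\<^esub>)"
  by (simp add: fun_eq_iff a_r_coset_def')

lemma zero_quotient_by [simp]: "\<zero>\<^bsub>quotient_by I\<^esub> = I"
  by (simp add: quotient_by_def quot_module_simps)

lemma carrier_quotient_by:
  "carrier (quotient_by I) = range (\<lambda>r :: ('n::finite, 'k::field_char_0) mpoly. I +>\<^bsub>mpoly_ring\<^esub> r)"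
  by (auto simp: quotient_by_def quot_module_simps A_RCOSETS_def' fun_eq_iff a_r_coset_def')

context
  fixes I :: "('n::finite, 'k::field_char_0) mpoly set"
  assumes I: "ideal I mpoly_ring"
begin

interpretation M: module mpoly_ring "regular_module mpoly_ring :: (('n, 'k) mpoly, ('n, 'k) mpoly) module"
  by (rule module_regular_module) (rule cring_mpoly_ring)

lemma ideal_submodule_regular: "submodule I mpoly_ring (regular_module mpoly_ring)"
  using I by (simp add: submodule_regular_iff)

lemma module_quotient_by: "module mpoly_ring (quotient_by I)"
  unfolding quotient_by_def by (rule M.module_quot_module[OF ideal_submodule_regular])

lemma quotient_by_smult:
  "a \<odot>\<^bsub>quotient_by I\<^esub> (I +>\<^bsub>mpoly_ring\<^esub> r) = I +>\<^bsub>mpoly_ring\<^esub> (a * r)"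
  unfolding quotient_by_def using M.quot_module_smult[OF ideal_submodule_regular, of a r] by simp

lemma quotient_by_add:
  "(I +>\<^bsub>mpoly_ring\<^esub> r) \<oplus>\<^bsub>quotient_by I\<^esub> (I +>\<^bsub>mpoly_ring\<^esub> s) = I +>\<^bsub>mpoly_ring\<^esub> (r + s)"
  unfolding quotient_by_def using M.quot_module_add[OF ideal_submodule_regular, of r s] by simp

lemma coset_eq_ideal_iff: "I +>\<^bsub>mpoly_ring\<^esub> r = I \<longleftrightarrow> r \<in> I"
  using M.coset_eq_self_iff[OF ideal_submodule_regular, of r] by simp

lemma coset_eq_coset_iff: "I +>\<^bsub>mpoly_ring\<^esub> r = I +>\<^bsub>mpoly_ring\<^esub> s \<longleftrightarrow> r - s \<in> I"
proof -
  have "r \<ominus>\<^bsub>regular_module mpoly_ring\<^esub> s = r - s"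
    by (simp add: M.minus_eq M.minus_equality[of "- s" s])
  then show ?thesis using M.coset_eq_iff[OF ideal_submodule_regular, of r s] by simp
qed

lemma coset_in_socle_iff:
  "I +>\<^bsub>mpoly_ring\<^esub> r \<in> socle (quotient_by I) \<longleftrightarrow> (\<forall>a\<in>max_ideal. a * r \<in> I)"
  by (auto simp: socle_def carrier_quotient_by quotient_by_smult coset_eq_ideal_iff)

lemma quotient_by_nilpotent:
  assumes nil: "\<exists>t. monomial (Poly_Mapping.single j t) \<in> I" and C: "C \<in> carrier (quotient_by I)"
  shows "\<exists>t. monomial (Poly_Mapping.single j t) \<odot>\<^bsub>quotient_by I\<^esub> C = \<zero>\<^bsub>quotient_by I\<^esub>"
proof -
  obtain r where r: "C = I +>\<^bsub>mpoly_ring\<^esub> r" using C by (auto simp: carrier_quotient_by)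
  obtain t where "monomial (Poly_Mapping.single j t) \<in> I" using nil by blast
  then have "r * monomial (Poly_Mapping.single j t) \<in> I" using I by (simp add: ideal_mpoly_iff)
  then have "monomial (Poly_Mapping.single j t) \<odot>\<^bsub>quotient_by I\<^esub> C = \<zero>\<^bsub>quotient_by I\<^esub>"
    by (simp add: r quotient_by_smult coset_eq_ideal_iff mult.commute)
  then show ?thesis ..
qed

text \<open>A finite-dimensional space of cosets has representatives supported on one finite set of
  exponents, so some power of each variable is congruent to a polynomial in which that power does not occur.\<close>

lemma finite_codim_imp_power_in_support:
  assumes "finite_codim I"
  shows "\<exists>t p. monomial (Poly_Mapping.single j t) - p \<in> I \<and> Poly_Mapping.single j t \<notin> Poly_Mapping.keys p"
proof -
  let ?Q = "(mpoly_ring :: ('n, 'k) mpoly ring) Quot I"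
  let ?K = "(\<lambda>c. I +>\<^bsub>mpoly_ring\<^esub> c) ` (constants :: ('n, 'k) mpoly set)"
  interpret I: ideal I mpoly_ring by (rule I)
  interpret Q: ring ?Q by (rule I.quotient_is_ring)
  have Qc: "carrier ?Q = range (\<lambda>r. I +>\<^bsub>mpoly_ring\<^esub> r)"
    by (auto simp: FactRing_def A_RCOSETS_def')
  have Qm: "(I +>\<^bsub>mpoly_ring\<^esub> r) \<otimes>\<^bsub>?Q\<^esub> (I +>\<^bsub>mpoly_ring\<^esub> s) = I +>\<^bsub>mpoly_ring\<^esub> (r * s)" for r s
    using I.rcoset_mult_add[of r s] by (simp add: FactRing_def)
  have Qa: "(I +>\<^bsub>mpoly_ring\<^esub> r) \<oplus>\<^bsub>?Q\<^esub> (I +>\<^bsub>mpoly_ring\<^esub> s) = I +>\<^bsub>mpoly_ring\<^esub> (r + s)" for r s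
    using I.a_rcos_sum[of r s] by (simp add: FactRing_def)
  \<comment> \<open>The induction follows the line extensions that build up
    \<open>dimension\<close>. Adjoining \<open>v\<close> enlarges \<open>F\<close> by the exponents
    of one representative \<open>q\<close>, since scaling \<open>q\<close> by a constant creates no
    new exponents.\<close>
  have key: "\<exists>F. finite F \<and> (\<forall>e\<in>E. \<exists>p. e = I +>\<^bsub>mpoly_ring\<^esub> p \<and> Poly_Mapping.keys p \<subseteq> F)"
    if "Q.dimension n ?K E" for n E
    using that
  proof (induction n "?K" E rule: Q.dimension.induct)
    case zero_dim
    have "\<zero>\<^bsub>?Q\<^esub> = I +>\<^bsub>mpoly_ring\<^esub> 0"
      using coset_eq_ideal_iff[of 0] I by (simp add: FactRing_def ideal_mpoly_iff)
    then show ?case by (intro exI[of _ "{}"]) auto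
  next
    case (Suc_dim v E n)
    then obtain F where F: "finite F"
      "\<forall>e\<in>E. \<exists>p. e = I +>\<^bsub>mpoly_ring\<^esub> p \<and> Poly_Mapping.keys p \<subseteq> F" by blast
    obtain q where q: "v = I +>\<^bsub>mpoly_ring\<^esub> q" using Suc_dim.hyps(1) by (auto simp: Qc)
    have "\<exists>p. u = I +>\<^bsub>mpoly_ring\<^esub> p \<and> Poly_Mapping.keys p \<subseteq> F \<union> Poly_Mapping.keys q"
      if u: "u \<in> Q.line_extension ?K v E" for u
    proof -
      obtain c e where c: "u = (I +>\<^bsub>mpoly_ring\<^esub> const_poly c) \<otimes>\<^bsub>?Q\<^esub> v \<oplus>\<^bsub>?Q\<^esub> e" and e: "e \<in> E"
        using u unfolding Q.line_extension_mem_iff constants_def by blast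
      obtain p where p: "e = I +>\<^bsub>mpoly_ring\<^esub> p" "Poly_Mapping.keys p \<subseteq> F" using F(2) e by blast
      have "u = I +>\<^bsub>mpoly_ring\<^esub> (const_poly c * q + p)" by (simp add: c p q Qm Qa)
      moreover have "Poly_Mapping.keys (const_poly c * q) \<subseteq> Poly_Mapping.keys q"
        by (auto simp: in_keys_iff lookup_const_poly_mult)
      then have "Poly_Mapping.keys (const_poly c * q + p) \<subseteq> F \<union> Poly_Mapping.keys q"
        using p(2) keys_add[of "const_poly c * q" p] by blast
      ultimately show ?thesis by blast
    qed
    then show ?case using F(1) by (intro exI[of _ "F \<union> Poly_Mapping.keys q"]) auto
  qed
  obtain n where "Q.dimension n ?K (carrier ?Q)"
    using assms unfolding finite_codim_def Q.finite_dimension_def by blast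
  from key[OF this] obtain F where fin: "finite F"
    and F: "\<forall>e\<in>carrier ?Q. \<exists>p. e = I +>\<^bsub>mpoly_ring\<^esub> p \<and> Poly_Mapping.keys p \<subseteq> F"
    by (elim exE conjE)
  have "inj (Poly_Mapping.single j :: nat \<Rightarrow> _)" by (rule inj_single)
  then have "infinite (range (Poly_Mapping.single j :: nat \<Rightarrow> _))" by (rule range_inj_infinite)
  then have "\<not> range (Poly_Mapping.single j :: nat \<Rightarrow> _) \<subseteq> F" using fin finite_subset by blast
  then obtain t where t: "Poly_Mapping.single j (t::nat) \<notin> F" by blast
  have "I +>\<^bsub>mpoly_ring\<^esub> monomial (Poly_Mapping.single j t) \<in> carrier ?Q" unfolding Qc by simp
  then obtain p where p: "I +>\<^bsub>mpoly_ring\<^esub> monomial (Poly_Mapping.single j t) = I +>\<^bsub>mpoly_ring\<^esub> p"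
    "Poly_Mapping.keys p \<subseteq> F" using bspec[OF F] by blast
  then show ?thesis using t coset_eq_coset_iff by blast
qed

end

section \<open>Membership in monomial ideals, tested on exponents\<close>

lemma monomial_ideal_imp_ideal:
  fixes I :: "('n::finite, 'k::field_char_0) mpoly set"
  assumes "monomial_ideal I"
  shows "ideal I mpoly_ring"
proof -
  interpret R: cring "mpoly_ring :: ('n, 'k) mpoly ring" by (rule cring_mpoly_ring)
  obtain A where "I = Idl\<^bsub>mpoly_ring\<^esub> (monomial ` A)" using assms by (auto simp: monomial_ideal_def)
  then show ?thesis by (simp add: R.genideal_ideal)
qed

text \<open>The polynomials whose monomials all lie in \<open>I\<close> form an ideal
  \<open>J\<close> that contains the generators, so \<open>J\<close> contains \<open>I\<close> by
  minimality of the generated ideal.\<close>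

lemma monomial_ideal_keys:
  fixes I :: "('n::finite, 'k::field_char_0) mpoly set"
  assumes mI: "monomial_ideal I" and "r \<in> I" "\<alpha> \<in> Poly_Mapping.keys r"
  shows "monomial \<alpha> \<in> I"
proof -
  interpret R: cring "mpoly_ring :: ('n, 'k) mpoly ring" by (rule cring_mpoly_ring)
  note I = monomial_ideal_imp_ideal[OF mI]
  obtain A where A: "I = Idl\<^bsub>mpoly_ring\<^esub> (monomial ` A)" using mI by (auto simp: monomial_ideal_def)
  define J where "J = {r :: ('n, 'k) mpoly. \<forall>\<alpha>\<in>Poly_Mapping.keys r. monomial \<alpha> \<in> I}"
  have "s * r \<in> J" if "r \<in> J" for r s
    unfolding J_def
  proof (clarify)
    fix \<alpha> assume "\<alpha> \<in> Poly_Mapping.keys (s * r)"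
    then obtain \<beta> \<delta> where "\<alpha> = \<beta> + \<delta>" "\<delta> \<in> Poly_Mapping.keys r" using keys_mult[of s r] by blast
    then have "monomial \<alpha> = monomial \<beta> * (monomial \<delta> :: ('n, 'k) mpoly)" "(monomial \<delta> :: ('n, 'k) mpoly) \<in> I"
      using that by (auto simp: mult_single J_def)
    then show "(monomial \<alpha> :: ('n, 'k) mpoly) \<in> I" using I by (simp add: ideal_mpoly_iff)
  qed
  moreover have "r + s \<in> J" if "r \<in> J" "s \<in> J" for r s
    using that keys_add[of r s] unfolding J_def by blast
  moreover have "0 \<in> J" by (simp add: J_def)
  ultimately have "ideal J mpoly_ring" unfolding ideal_mpoly_iff by blast
  moreover have "monomial ` A \<subseteq> I" unfolding A by (rule R.genideal_self) simp
  then have "monomial ` A \<subseteq> J" by (auto simp: J_def)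
  ultimately have "I \<subseteq> J" unfolding A by (rule R.genideal_minimal)
  then show ?thesis using assms by (auto simp: J_def)
qed

text \<open>In the element \<open>x_j^t - p\<close> of \<open>I\<close> the power
  \<open>x_j^t\<close> keeps its coefficient 1, as it does not occur in \<open>p\<close>.
  Monomiality then puts that power itself into \<open>I\<close>.\<close>

lemma monomial_ideal_nilpotent:
  fixes I :: "('n::finite, 'k::field_char_0) mpoly set"
  assumes mI: "monomial_ideal I" and "finite_codim I"
  shows "\<exists>t. monomial (Poly_Mapping.single j t) \<in> I"
proof -
  obtain t p where "monomial (Poly_Mapping.single j t) - p \<in> I" "Poly_Mapping.single j t \<notin> Poly_Mapping.keys p"
    using finite_codim_imp_power_in_support[OF monomial_ideal_imp_ideal[OF mI] assms(2)] by blast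
  then show ?thesis
    using monomial_ideal_keys[OF mI, of "monomial (Poly_Mapping.single j t) - p" "Poly_Mapping.single j t"]
    by (auto simp: in_keys_iff lookup_minus)
qed

text \<open>By monomiality an element with nonzero constant term would put 1 into
  \<open>I\<close>.\<close>

lemma proper_monomial_ideal_subset_max_ideal:
  fixes I :: "('n::finite, 'k::field_char_0) mpoly set"
  assumes mI: "monomial_ideal I" and "I \<noteq> UNIV"
  shows "I \<subseteq> max_ideal"
proof
  fix r assume r: "r \<in> I"
  have "1 \<notin> I"
  proof
    assume "1 \<in> I"
    then have "s * 1 \<in> I" for s using monomial_ideal_imp_ideal[OF mI] unfolding ideal_mpoly_iff by blast
    then show False using \<open>I \<noteq> UNIV\<close> by auto
  qed
  then have "0 \<notin> Poly_Mapping.keys r" using monomial_ideal_keys[OF mI r, of 0] by auto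
  then show "r \<in> max_ideal" by (simp add: max_ideal_iff in_keys_iff)
qed

section \<open>Perpendicular spaces of monomial ideals and of the constants\<close>

lemma ideal_perp_submodule:
  "submodule (ideal_perp I) mpoly_ring (Gamma_module :: (('n::finite, 'k::field_char_0) mpoly, _) module)"
proof -
  have "apolar r (apolar s \<gamma>) = apolar s (apolar r \<gamma>)" for r s \<gamma> :: "('n, 'k) mpoly"
    by (metis apolar_mult mult.commute)
  then show ?thesis by (simp add: submodule_Gamma_iff ideal_perp_def apolar_add_right)
qed

lemma ideal_perp_monomial_iff:
  fixes I :: "('n::finite, 'k::field_char_0) mpoly set"
  assumes mI: "monomial_ideal I"
  shows "\<gamma> \<in> ideal_perp I \<longleftrightarrow> (\<forall>\<beta>\<in>Poly_Mapping.keys \<gamma>. monomial \<beta> \<notin> I)"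
proof (intro iffI ballI notI)
  fix \<beta> assume "\<gamma> \<in> ideal_perp I" "\<beta> \<in> Poly_Mapping.keys \<gamma>" "monomial \<beta> \<in> I"
  \<comment> \<open>This constant term is the coefficient of \<open>\<gamma>\<close> at
    \<open>\<beta>\<close> times \<open>\<beta>!\<close>, hence nonzero for \<open>\<beta>\<close>
    in the support.\<close>
  then have "Poly_Mapping.lookup (apolar (monomial \<beta>) \<gamma>) 0 = 0" by (simp add: ideal_perp_def)
  then show False using \<open>\<beta> \<in> Poly_Mapping.keys \<gamma>\<close> by (simp add: lookup_apolar_single in_keys_iff)
next
  assume \<gamma>: "\<forall>\<beta>\<in>Poly_Mapping.keys \<gamma>. monomial \<beta> \<notin> I"
  \<comment> \<open>These are the coefficients of \<open>\<gamma>\<close> entering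
    \<open>apolar r \<gamma>\<close>. Their exponents are multiples of an exponent of
    \<open>r\<close>, so the corresponding monomials lie in \<open>I\<close> and are absent from
    \<open>\<gamma>\<close>.\<close>
  have "Poly_Mapping.lookup \<gamma> (\<alpha> + \<delta>) = 0" if "r \<in> I" "\<alpha> \<in> Poly_Mapping.keys r" for r \<alpha> \<delta>
  proof -
    have "monomial \<delta> * monomial \<alpha> \<in> I"
      using monomial_ideal_keys[OF mI that] monomial_ideal_imp_ideal[OF mI] unfolding ideal_mpoly_iff by blast
    then show ?thesis using \<gamma> by (auto simp: mult_single add.commute in_keys_iff)
  qed
  then show "\<gamma> \<in> ideal_perp I"
    by (auto simp: ideal_perp_def lookup_apolar[OF finite_keys order_refl] intro!: poly_mapping_eqI sum.neutral)
qed

text \<open>If a monomial of \<open>r\<close> at \<open>\<alpha>\<close> were outside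
  \<open>I\<close>, the same monomial would belong to the perp and could serve as a test element:
  applying \<open>r\<close> to it leaves as constant term the coefficient of \<open>r\<close> at
  \<open>\<alpha>\<close> times \<open>\<alpha>!\<close>, which is nonzero.\<close>

lemma submodule_perp_ideal_perp:
  fixes I :: "('n::finite, 'k::field_char_0) mpoly set"
  assumes mI: "monomial_ideal I"
  shows "submodule_perp (ideal_perp I) = I"
proof (intro equalityI subsetI)
  fix r assume r: "r \<in> submodule_perp (ideal_perp I)"
  show "r \<in> I"
  proof (rule ideal_memI_singles[OF monomial_ideal_imp_ideal[OF mI]], rule ccontr)
    fix \<alpha> assume \<alpha>: "\<alpha> \<in> Poly_Mapping.keys r" and "monomial \<alpha> \<notin> I"
    then have "monomial \<alpha> \<in> ideal_perp I" by (simp add: ideal_perp_monomial_iff[OF mI])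
    then have "Poly_Mapping.lookup (apolar r (monomial \<alpha>)) 0 = 0" using r by (simp add: submodule_perp_def)
    moreover have "Poly_Mapping.lookup (apolar r (monomial \<alpha>)) 0 =
        (\<Sum>\<beta>\<in>Poly_Mapping.keys r. if \<beta> = \<alpha> then Poly_Mapping.lookup r \<alpha> * (exponent_fact \<alpha> / exponent_fact (0 :: 'n \<Rightarrow>\<^sub>0 nat)) else 0)"
      unfolding lookup_apolar[OF finite_keys order_refl]
      by (intro sum.cong) (auto simp: lookup_single when_def)
    ultimately show False using \<alpha> by (simp add: in_keys_iff)
  qed
qed (auto simp: submodule_perp_def ideal_perp_def)

lemma submodule_perp_constants:
  "submodule_perp constants = (max_ideal :: ('n::finite, 'k::field_char_0) mpoly set)"
proof -
  have "(\<forall>c. const_poly (Poly_Mapping.lookup r 0 * c) = (0 :: ('n, 'k) mpoly)) \<longleftrightarrow> Poly_Mapping.lookup r 0 = 0"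
    for r :: "('n, 'k) mpoly"
    by (metis lookup_single_eq lookup_zero mult_zero_left mult.right_neutral single_zero)
  then show ?thesis by (auto simp: submodule_perp_def constants_def apolar_const_right max_ideal_iff)
qed

section \<open>Macaulay duals\<close>

lemma (in module) generated_submodule:
  assumes S: "S \<subseteq> carrier M"
  shows "submodule (generated_submodule R M S) R M"
    and "S \<subseteq> generated_submodule R M S"
    and "submodule N R M \<Longrightarrow> S \<subseteq> N \<Longrightarrow> generated_submodule R M S \<subseteq> N"
proof -
  \<comment> \<open>An intersection over an empty family would be the whole type, not a subset of
    the carrier.\<close>
  have ex: "\<exists>N. submodule N R M \<and> S \<subseteq> N" using S carrier_is_submodule by blast
  have zero: "\<zero>\<^bsub>M\<^esub> \<in> N" if "submodule N R M" for N
    using subgroup.one_closed[OF submodule.axioms(1)[OF that]] by simp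
  show "submodule (generated_submodule R M S) R M"
    unfolding generated_submodule_def
  proof (rule submoduleI)
    fix a b assume "a \<in> \<Inter>{N. submodule N R M \<and> S \<subseteq> N}" "b \<in> \<Inter>{N. submodule N R M \<and> S \<subseteq> N}"
    then show "a \<oplus>\<^bsub>M\<^esub> b \<in> \<Inter>{N. submodule N R M \<and> S \<subseteq> N}"
      by (blast intro: submoduleE(5))
  qed (use ex zero in \<open>auto dest: submoduleE\<close>)
qed (auto simp: generated_submodule_def)

text \<open>The inverse in \<open>submodule\<close> is computed in the ambient module, here with
  carrier \<open>P\<close>. It is the action of -1 in either ambient module, so the two notions
  agree.\<close>

lemma submodule_Gamma_restrict_iff:
  fixes N P :: "('n::finite, 'k::field_char_0) mpoly set"
  assumes P: "submodule P mpoly_ring Gamma_module"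
  shows "submodule N mpoly_ring (Gamma_module\<lparr>carrier := P\<rparr>) \<longleftrightarrow>
    N \<subseteq> P \<and> submodule N mpoly_ring Gamma_module"
proof -
  interpret P: module mpoly_ring "Gamma_module\<lparr>carrier := P\<rparr>" by (rule module_Gamma_submodule[OF P])
  have neg: "\<ominus>\<^bsub>Gamma_module\<lparr>carrier := P\<rparr>\<^esub> x = apolar (- 1) x" if "x \<in> P" for x
    by (rule P.M.minus_equality)
      (use that P apolar_add_left[of "- 1" 1 x] in \<open>simp_all add: submodule_Gamma_iff\<close>)
  show ?thesis
  proof
    assume N: "submodule N mpoly_ring (Gamma_module\<lparr>carrier := P\<rparr>)"
    show "N \<subseteq> P \<and> submodule N mpoly_ring Gamma_module"
      using P.submoduleE[OF N] subgroup.one_closed[OF submodule.axioms(1)[OF N]]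
      by (simp add: submodule_Gamma_iff)
  next
    assume N: "N \<subseteq> P \<and> submodule N mpoly_ring Gamma_module"
    show "submodule N mpoly_ring (Gamma_module\<lparr>carrier := P\<rparr>)"
    proof (rule P.submoduleI)
      fix x assume "x \<in> N"
      then show "\<ominus>\<^bsub>Gamma_module\<lparr>carrier := P\<rparr>\<^esub> x \<in> N"
        using N neg[of x] by (auto simp: submodule_Gamma_iff)
    qed (use N in \<open>auto simp: submodule_Gamma_iff\<close>)
  qed
qed

lemma module_dual_of_quotient:
  "module mpoly_ring (dual_of_quotient (I :: ('n::finite, 'k::field_char_0) mpoly set))"
  unfolding dual_of_quotient_def by (rule module_Gamma_submodule[OF ideal_perp_submodule])

lemma dual_of_quotient_simps [simp]:
  "carrier (dual_of_quotient I) = ideal_perp I" "\<zero>\<^bsub>dual_of_quotient I\<^esub> = 0"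
  "(\<oplus>\<^bsub>dual_of_quotient I\<^esub>) = (+)" "(\<odot>\<^bsub>dual_of_quotient I\<^esub>) = apolar"
  by (simp_all add: dual_of_quotient_def)

lemma max_ideal_apolar_perp_submodule:
  fixes I :: "('n::finite, 'k::field_char_0) mpoly set"
  shows "submodule (max_ideal_apolar_perp I) mpoly_ring (dual_of_quotient I)"
    and "a \<in> max_ideal \<Longrightarrow> \<gamma> \<in> ideal_perp I \<Longrightarrow> apolar a \<gamma> \<in> max_ideal_apolar_perp I"
    and "submodule N mpoly_ring (dual_of_quotient I) \<Longrightarrow>
      (\<And>a \<gamma>. a \<in> max_ideal \<Longrightarrow> \<gamma> \<in> ideal_perp I \<Longrightarrow> apolar a \<gamma> \<in> N) \<Longrightarrow> max_ideal_apolar_perp I \<subseteq> N"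
proof -
  interpret module mpoly_ring "dual_of_quotient I" by (rule module_dual_of_quotient)
  let ?S = "{apolar a \<gamma> | a \<gamma>. a \<in> max_ideal \<and> \<gamma> \<in> ideal_perp I}"
  have S: "?S \<subseteq> carrier (dual_of_quotient I)"
    using ideal_perp_submodule[of I] by (auto simp: submodule_Gamma_iff)
  note gen = generated_submodule[OF S, folded max_ideal_apolar_perp_def]
  show "submodule (max_ideal_apolar_perp I) mpoly_ring (dual_of_quotient I)" by (rule gen(1))
  show "apolar a \<gamma> \<in> max_ideal_apolar_perp I" if "a \<in> max_ideal" "\<gamma> \<in> ideal_perp I"
    using gen(2) that by blast
  show "max_ideal_apolar_perp I \<subseteq> N" if "submodule N mpoly_ring (dual_of_quotient I)"
    "\<And>a \<gamma>. a \<in> max_ideal \<Longrightarrow> \<gamma> \<in> ideal_perp I \<Longrightarrow> apolar a \<gamma> \<in> N"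
    using gen(3) that by blast
qed

text \<open>A monomial \<open>X\<^sup>\<beta>\<close> in the support of \<open>\<gamma> \<in> I\<^sup>\<bottom>\<close> is a multiple of \<open>x\<^sub>j \<circ> (X\<^sub>j X\<^sup>\<beta>)\<close>, which lies in
  \<open>\<mm> \<circ> I\<^sup>\<bottom>\<close> unless \<open>x\<^sup>\<beta>\<close> is a socle element of \<open>R/I\<close>; and such a socle element detects the coefficient of \<open>X\<^sup>\<beta>\<close>.\<close>

lemma socle_annihilator_eq_max_ideal_apolar_perp:
  fixes I :: "('n::finite, 'k::field_char_0) mpoly set"
  assumes mI: "monomial_ideal I"
  shows "{\<gamma> \<in> ideal_perp I. \<forall>r. I +>\<^bsub>mpoly_ring\<^esub> r \<in> socle (quotient_by I) \<longrightarrow> apolar r \<gamma> = 0}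
    = max_ideal_apolar_perp I" (is "?L = _")
proof (intro equalityI subsetI)
  note I = monomial_ideal_imp_ideal[OF mI]
  fix \<gamma> assume \<gamma>: "\<gamma> \<in> ?L"
  have sub: "submodule (max_ideal_apolar_perp I) mpoly_ring Gamma_module"
    using max_ideal_apolar_perp_submodule(1)[of I] ideal_perp_submodule[of I]
    by (simp add: submodule_Gamma_restrict_iff dual_of_quotient_def)
  have single: "Poly_Mapping.single \<beta> (Poly_Mapping.lookup \<gamma> \<beta>) \<in> max_ideal_apolar_perp I"
    if \<beta>: "\<beta> \<in> Poly_Mapping.keys \<gamma>" for \<beta>
  proof -
    have "\<not> (\<forall>a\<in>max_ideal. a * monomial \<beta> \<in> I)"
    proof
      assume "\<forall>a\<in>max_ideal. a * monomial \<beta> \<in> I"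
      then have "apolar (monomial \<beta>) \<gamma> = 0" using \<gamma> by (simp add: coset_in_socle_iff[OF I])
      then have "Poly_Mapping.lookup (apolar (monomial \<beta>) \<gamma>) 0 = 0" by simp
      then show False using \<beta> by (simp add: lookup_apolar_single in_keys_iff)
    qed
    moreover have "ideal {a. a * monomial \<beta> \<in> I} mpoly_ring"
      using I by (simp add: ideal_mpoly_iff distrib_right mult.assoc)
    ultimately obtain j where j: "monomial (Poly_Mapping.single j 1) * monomial \<beta> \<notin> I"
      using max_ideal_subset[of "{a. a * monomial \<beta> \<in> I}"] by blast
    define \<beta>' where "\<beta>' = Poly_Mapping.single j 1 + \<beta>"
    \<comment> \<open>The coefficient is chosen to cancel the factor
      \<open>\<beta>'!/\<beta>!\<close> that differentiation by \<open>X_j\<close> produces, so that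
      the derivative is exactly the \<open>\<beta>\<close>-term of \<open>\<gamma>\<close>.\<close>
    define d :: 'k where "d = Poly_Mapping.lookup \<gamma> \<beta> * exponent_fact \<beta> / exponent_fact \<beta>'"
    have "Poly_Mapping.single \<beta>' d \<in> ideal_perp I"
      using j by (auto simp: ideal_perp_monomial_iff[OF mI] mult_single \<beta>'_def)
    then have "apolar (monomial (Poly_Mapping.single j 1)) (Poly_Mapping.single \<beta>' d) \<in> max_ideal_apolar_perp I"
      by (rule max_ideal_apolar_perp_submodule(2)[OF variable_in_max_ideal])
    also have "apolar (monomial (Poly_Mapping.single j 1)) (Poly_Mapping.single \<beta>' d)
      = Poly_Mapping.single \<beta> (Poly_Mapping.lookup \<gamma> \<beta>)"
      by (rule poly_mapping_eqI)
        (auto simp: lookup_apolar_single lookup_single when_def \<beta>'_def d_def)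
    finally show ?thesis .
  qed
  have "(\<Sum>\<beta>\<in>A. Poly_Mapping.single \<beta> (Poly_Mapping.lookup \<gamma> \<beta>)) \<in> max_ideal_apolar_perp I"
    if "finite A" "A \<subseteq> Poly_Mapping.keys \<gamma>" for A
    using that by induction (use single sub in \<open>auto simp: submodule_Gamma_iff\<close>)
  then show "\<gamma> \<in> max_ideal_apolar_perp I" by (subst mpoly_eq_sum_single) simp
next
  note I = monomial_ideal_imp_ideal[OF mI]
  note P = ideal_perp_submodule[of I, unfolded submodule_Gamma_iff]
  have comm: "apolar r (apolar s \<gamma>) = apolar s (apolar r \<gamma>)" for r s \<gamma> :: "('n, 'k) mpoly"
    by (metis apolar_mult mult.commute)
  \<comment> \<open>As a submodule, the annihilator only has to contain the generators
    \<open>apolar a \<gamma>\<close>. There \<open>r\<close> and \<open>a\<close> commute, and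
    \<open>a * r\<close> lies in \<open>I\<close> because the class of \<open>r\<close> is in the
    socle.\<close>
  have "submodule ?L mpoly_ring (dual_of_quotient I)"
    unfolding dual_of_quotient_def submodule_Gamma_restrict_iff[OF ideal_perp_submodule]
    using P by (auto simp: submodule_Gamma_iff apolar_add_right comm[of _ _])
  moreover have "apolar a \<gamma> \<in> ?L" if a: "a \<in> max_ideal" and \<gamma>: "\<gamma> \<in> ideal_perp I" for a \<gamma>
  proof -
    have "apolar r (apolar a \<gamma>) = 0" if "I +>\<^bsub>mpoly_ring\<^esub> r \<in> socle (quotient_by I)" for r
    proof -
      have "a * r \<in> I" using that a by (simp add: coset_in_socle_iff[OF I])
      then have "apolar (a * r) \<gamma> = 0" using \<gamma> by (simp add: ideal_perp_def)
      then show ?thesis using comm[of r a \<gamma>] by (simp add: apolar_mult)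
    qed
    then show ?thesis using P \<gamma> by simp
  qed
  ultimately have "max_ideal_apolar_perp I \<subseteq> ?L" by (rule max_ideal_apolar_perp_submodule(3))
  then show "\<gamma> \<in> ?L" if "\<gamma> \<in> max_ideal_apolar_perp I" for \<gamma> using that by blast
qed

lemma quotient_by_max_ideal_apolar_perp_annihilated:
  fixes I :: "('n::finite, 'k::field_char_0) mpoly set"
  assumes b: "b \<in> max_ideal"
    and C: "C \<in> carrier (quot_module (dual_of_quotient I) (max_ideal_apolar_perp I))"
  shows "b \<odot>\<^bsub>quot_module (dual_of_quotient I) (max_ideal_apolar_perp I)\<^esub> C =
    \<zero>\<^bsub>quot_module (dual_of_quotient I) (max_ideal_apolar_perp I)\<^esub>"
proof -
  interpret module mpoly_ring "dual_of_quotient I" by (rule module_dual_of_quotient)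
  note S = max_ideal_apolar_perp_submodule[where I = I]
  obtain \<gamma> where \<gamma>: "\<gamma> \<in> carrier (dual_of_quotient I)" "C = max_ideal_apolar_perp I +>\<^bsub>dual_of_quotient I\<^esub> \<gamma>"
    using C by (rule quot_module_carrierE)
  have "apolar b \<gamma> \<in> max_ideal_apolar_perp I" using S(2)[OF b] \<gamma>(1) by simp
  moreover have "apolar b \<gamma> \<in> ideal_perp I"
    using \<gamma>(1) ideal_perp_submodule[of I] by (simp add: submodule_Gamma_iff)
  ultimately show ?thesis
    using quot_module_smult[OF S(1), of b \<gamma>] coset_eq_self_iff[OF S(1), of "apolar b \<gamma>"] \<gamma>
    by (simp add: quot_module_simps)
qed

text \<open>Nilpotency of the variables passes to every quotient, so a reduced quotient equals its
  own socle and \<open>N\<close> contains the image of \<open>max_ideal\<close>. That image is a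
  maximal submodule, so a larger \<open>N\<close> would make the quotient zero.\<close>

lemma reduced_quotients_quotient_by:
  fixes I :: "('n::finite, 'k::field_char_0) mpoly set"
  assumes I: "ideal I mpoly_ring" and Im: "I \<subseteq> max_ideal"
    and nil: "\<And>j. \<exists>t. monomial (Poly_Mapping.single j t) \<in> I"
  shows "submodule N mpoly_ring (quotient_by I) \<and> nonzero_module (quot_module (quotient_by I) N) \<and>
      reduced_module mpoly_ring (quot_module (quotient_by I) N) \<longleftrightarrow>
    N = (\<lambda>r. I +>\<^bsub>mpoly_ring\<^esub> r) ` max_ideal" (is "_ \<longleftrightarrow> N = ?K")
proof -
  let ?M = "quotient_by I"
  let ?c = "\<lambda>r. I +>\<^bsub>mpoly_ring\<^esub> r"
  interpret R: module mpoly_ring "regular_module mpoly_ring :: (('n, 'k) mpoly, ('n, 'k) mpoly) module"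
    by (rule module_regular_module) (rule cring_mpoly_ring)
  interpret M: module mpoly_ring ?M by (rule module_quotient_by[OF I])
  have cc: "?c r \<in> carrier ?M" for r by (simp add: carrier_quotient_by)
  have smult: "a \<odot>\<^bsub>quot_module ?M N\<^esub> (N +>\<^bsub>?M\<^esub> ?c r) = N +>\<^bsub>?M\<^esub> ?c (a * r)"
    if "submodule N mpoly_ring ?M" for a r N
    using M.quot_module_smult[OF that _ cc] by (simp add: quotient_by_smult[OF I])
  have zero: "N +>\<^bsub>?M\<^esub> ?c r = N \<longleftrightarrow> ?c r \<in> N" if "submodule N mpoly_ring ?M" for r N
    using M.coset_eq_self_iff[OF that cc] .
  have closed: "?c (a * r) \<in> N" if "submodule N mpoly_ring ?M" "?c r \<in> N" for a r N
    using M.submoduleE(4)[OF that(1) _ that(2)] by (simp add: quotient_by_smult[OF I])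
  have QE: "\<exists>r. C = N +>\<^bsub>?M\<^esub> ?c r" if "C \<in> carrier (quot_module ?M N)" for C N
    using that by (auto elim!: quot_module_carrierE simp: carrier_quotient_by)
  have K: "submodule ?K mpoly_ring ?M"
    using R.submodule_image_coset[OF ideal_submodule_regular[OF I] ideal_submodule_regular[OF max_ideal_ideal]]
    by (simp add: quotient_by_def)
  \<comment> \<open>Containment of \<open>I\<close> in \<open>max_ideal\<close> makes this
    independent of the representative \<open>r\<close>.\<close>
  have Kiff: "?c r \<in> ?K \<longleftrightarrow> r \<in> max_ideal" for r
  proof
    assume "?c r \<in> ?K"
    then obtain s where s: "s \<in> max_ideal" "r - s \<in> max_ideal"
      using Im by (auto simp: coset_eq_coset_iff[OF I])
    then show "r \<in> max_ideal" by (simp add: max_ideal_iff lookup_minus)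
  qed simp
  show ?thesis
  proof (intro iffI conjI; (elim conjE)?)
    assume N: "submodule N mpoly_ring ?M" and nz: "nonzero_module (quot_module ?M N)"
      and red: "reduced_module mpoly_ring (quot_module ?M N)"
    have Q: "module mpoly_ring (quot_module ?M N)" by (rule M.module_quot_module[OF N])
    have "\<exists>t. monomial (Poly_Mapping.single j t) \<odot>\<^bsub>quot_module ?M N\<^esub> C = \<zero>\<^bsub>quot_module ?M N\<^esub>"
      if C: "C \<in> carrier (quot_module ?M N)" for j C
    proof -
      obtain r where r: "C = N +>\<^bsub>?M\<^esub> ?c r" using QE[OF C] by blast
      obtain t where "monomial (Poly_Mapping.single j t) \<in> I" using nil by blast
      then have "r * monomial (Poly_Mapping.single j t) \<in> I" using I by (simp add: ideal_mpoly_iff)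
      then have "?c (monomial (Poly_Mapping.single j t) * r) = I"
        by (simp add: coset_eq_ideal_iff[OF I] mult.commute)
      moreover have "I \<in> N"
        using subgroup.one_closed[OF submodule.axioms(1)[OF N]] by simp
      ultimately have "?c (monomial (Poly_Mapping.single j t) * r) \<in> N" by simp
      then have "N +>\<^bsub>?M\<^esub> ?c (monomial (Poly_Mapping.single j t) * r) = N"
        by (simp only: zero[OF N])
      then show ?thesis by (auto simp: r smult[OF N] quot_module_simps)
    qed
    from reduced_part_eq_socle[OF Q this]
    have soc: "socle (quot_module ?M N) = carrier (quot_module ?M N)"
      using red by (simp add: reduced_module_iff)
    have KN: "?K \<subseteq> N"
    proof
      fix C assume "C \<in> ?K"
      then obtain r where r: "r \<in> max_ideal" "C = ?c r" by blast
      \<comment> \<open>The class of 1 generates the quotient; that \<open>r\<close> kills it says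
        exactly that the class of \<open>r\<close> lies in \<open>N\<close>.\<close>
      have "N +>\<^bsub>?M\<^esub> ?c 1 \<in> socle (quot_module ?M N)"
        unfolding soc by (rule M.quot_module_carrierI[OF cc])
      then have "r \<odot>\<^bsub>quot_module ?M N\<^esub> (N +>\<^bsub>?M\<^esub> ?c 1) = N"
        using r by (simp add: socle_def quot_module_simps)
      then show "C \<in> N" using smult[OF N, of r 1] zero[OF N, of r] r by simp
    qed
    moreover have "N \<subseteq> ?K"
    proof (rule ccontr)
      assume "\<not> N \<subseteq> ?K"
      then obtain C where C: "C \<in> N" "C \<notin> ?K" by blast
      then have "C \<in> carrier ?M" using M.submoduleE(1)[OF N] by blast
      then obtain r where r: "C = ?c r" by (auto simp: carrier_quotient_by)
      \<comment> \<open>Inverts the constant term of \<open>r\<close>, so \<open>u * r\<close> is 1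
        modulo \<open>max_ideal\<close>. As \<open>N\<close> contains the classes of
        \<open>u * r\<close> and of \<open>1 - u * r\<close>, it contains that of 1.\<close>
      define u :: "('n, 'k) mpoly" where "u = const_poly (inverse (Poly_Mapping.lookup r 0))"
      have "Poly_Mapping.lookup r 0 \<noteq> 0" using C Kiff by (simp add: r max_ideal_iff)
      then have "1 - u * r \<in> max_ideal"
        by (simp add: max_ideal_iff lookup_minus lookup_mult_0 u_def)
      then have "?c (1 - u * r) \<in> N" using KN by blast
      moreover have "?c (u * r) \<in> N" using closed[OF N] C r by blast
      ultimately have "?c (1 - u * r) \<oplus>\<^bsub>?M\<^esub> ?c (u * r) \<in> N" by (rule M.submoduleE(5)[OF N])
      then have one: "?c 1 \<in> N" by (simp add: quotient_by_add[OF I])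
      have "C = N" if C: "C \<in> carrier (quot_module ?M N)" for C
      proof -
        obtain s where s: "C = N +>\<^bsub>?M\<^esub> ?c s" using QE[OF C] by blast
        have "?c s \<in> N" using closed[OF N one, of s] by simp
        then show ?thesis by (simp add: s zero[OF N])
      qed
      then have "carrier (quot_module ?M N) \<subseteq> {N}" by blast
      moreover have "N \<in> carrier (quot_module ?M N)"
        using M.quot_module_carrierI[OF cc, of N 1] zero[OF N, of 1] one by simp
      ultimately show False using nz by (auto simp: nonzero_module_def quot_module_simps)
    qed
    ultimately show "N = ?K" by blast
  next
    assume N: "N = ?K"
    show "submodule N mpoly_ring ?M" unfolding N by (rule K)
    have "1 \<notin> (max_ideal :: ('n, 'k) mpoly set)" by (simp add: max_ideal_iff)
    then have "?K +>\<^bsub>?M\<^esub> ?c 1 \<noteq> ?K" by (simp only: zero[OF K] Kiff not_False_eq_True)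
    moreover have "?K +>\<^bsub>?M\<^esub> ?c 1 \<in> carrier (quot_module ?M ?K)"
      by (rule M.quot_module_carrierI[OF cc])
    ultimately show "nonzero_module (quot_module ?M N)"
      unfolding N nonzero_module_def by (auto simp: quot_module_simps)
    show "reduced_module mpoly_ring (quot_module ?M N)"
      unfolding N
    proof (rule annihilated_by_max_ideal_imp_reduced_coreduced(1)[OF M.module_quot_module[OF K]])
      fix b :: "('n, 'k) mpoly" and C assume b: "b \<in> max_ideal" and C: "C \<in> carrier (quot_module ?M ?K)"
      obtain r where r: "C = ?K +>\<^bsub>?M\<^esub> ?c r" using QE[OF C] by blast
      have "b * r \<in> max_ideal" using b by (simp add: max_ideal_iff lookup_mult_0)
      then show "b \<odot>\<^bsub>quot_module ?M ?K\<^esub> C = \<zero>\<^bsub>quot_module ?M ?K\<^esub>"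
        unfolding r smult[OF K] quot_module_simps zero[OF K] Kiff .
    qed
  qed
qed

theorem corollary3p1:
  fixes I :: "('n::finite, 'k::{alg_closed_field, field_char_0}) mpoly set"
  assumes "monomial_ideal I"
    and "I \<noteq> carrier mpoly_ring"
    and "finite_codim I"
  shows
    "(submodule (max_ideal_apolar_perp I) mpoly_ring (dual_of_quotient I) \<and>
      dual_of_quotient_submodule I (reduced_part mpoly_ring (quotient_by I)) =
        quot_module (dual_of_quotient I) (max_ideal_apolar_perp I) \<and>
      reduced_module mpoly_ring (quot_module (dual_of_quotient I) (max_ideal_apolar_perp I)) \<and>
      coreduced_module mpoly_ring (quot_module (dual_of_quotient I) (max_ideal_apolar_perp I)))
     \<and>
     (reduced_part mpoly_ring (dual_of_quotient I) = constants \<and>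
      (\<forall>N :: ('n, 'k) mpoly set. submodule N mpoly_ring Gamma_module \<and>
         nonzero_module (Gamma_module\<lparr>carrier := N\<rparr>) \<and>
         reduced_module mpoly_ring (Gamma_module\<lparr>carrier := N\<rparr>) \<longleftrightarrow> N = constants))
     \<and>
     (let D = dual_of_submodule (reduced_part mpoly_ring (dual_of_quotient I));
          K = (\<lambda>r. I +>\<^bsub>mpoly_ring\<^esub> r) `
                submodule_perp (reduced_part mpoly_ring (dual_of_quotient I))
      in module_isomorphic mpoly_ring D (quotient_by max_ideal) \<and>
         module_isomorphic mpoly_ring (quot_module (quotient_by I) K) D \<and>
         (\<forall>N. submodule N mpoly_ring (quotient_by I) \<and>
            nonzero_module (quot_module (quotient_by I) N) \<and>
            reduced_module mpoly_ring (quot_module (quotient_by I) N) \<longleftrightarrow> N = K))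
     \<and>
     (reduced_part mpoly_ring (dual_of_submodule (ideal_perp I)) =
        reduced_part mpoly_ring (quotient_by I) \<and>
      submodule (reduced_part mpoly_ring (quotient_by I)) mpoly_ring (quotient_by I) \<and>
      reduced_module mpoly_ring
        ((quotient_by I)\<lparr>carrier := reduced_part mpoly_ring (quotient_by I)\<rparr>) \<and>
      coreduced_module mpoly_ring
        ((quotient_by I)\<lparr>carrier := reduced_part mpoly_ring (quotient_by I)\<rparr>))"
proof -
  have I: "ideal I mpoly_ring" by (rule monomial_ideal_imp_ideal[OF assms(1)])
  have nil: "\<exists>t. monomial (Poly_Mapping.single j t) \<in> I" for j
    by (rule monomial_ideal_nilpotent[OF assms(1,3)])
  have Im: "I \<subseteq> max_ideal"
    by (rule proper_monomial_ideal_subset_max_ideal[OF assms(1)]) (use assms(2) in simp)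
  have M: "module mpoly_ring (quotient_by I)" by (rule module_quotient_by[OF I])
  have socle: "reduced_part mpoly_ring (quotient_by I) = socle (quotient_by I)"
    by (rule reduced_part_eq_socle[OF M quotient_by_nilpotent[OF I nil]])
  have S: "submodule (socle (quotient_by I)) mpoly_ring (quotient_by I)"
    by (rule socle_submodule[OF M])
  interpret dual: module mpoly_ring "dual_of_quotient I" by (rule module_dual_of_quotient)
  interpret R: module mpoly_ring "regular_module mpoly_ring :: (('n, 'k) mpoly, ('n, 'k) mpoly) module"
    by (rule module_regular_module) (rule cring_mpoly_ring)
  note red_quot = annihilated_by_max_ideal_imp_reduced_coreduced[OF
      dual.module_quot_module[OF max_ideal_apolar_perp_submodule(1)]
      quotient_by_max_ideal_apolar_perp_annihilated]
  have red_soc: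
    "reduced_module mpoly_ring ((quotient_by I)\<lparr>carrier := socle (quotient_by I)\<rparr>)"
    "coreduced_module mpoly_ring ((quotient_by I)\<lparr>carrier := socle (quotient_by I)\<rparr>)"
    by (rule annihilated_by_max_ideal_imp_reduced_coreduced[OF submodule.submodule_is_module[OF S M]];
      simp add: socle_def)+
  have "constants \<subseteq> ideal_perp I"
    using Im by (auto simp: ideal_perp_def constants_def apolar_const_right max_ideal_iff subset_iff)
  then have const: "reduced_part mpoly_ring (dual_of_quotient I) = constants"
    unfolding dual_of_quotient_def reduced_part_Gamma_submodule[OF ideal_perp_submodule] by blast
  \<comment> \<open>After rewriting, D is literally R/\<open>max_ideal\<close>, the double perp is
    \<open>I\<close>, and the kernel in item 1 is \<open>max_ideal_apolar_perp I\<close>. The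
    corresponding claims become reflexivity, and only the iterated quotient needs an
    isomorphism.\<close>
  show ?thesis
    unfolding Let_def const submodule_perp_constants socle dual_of_submodule_def
      submodule_perp_ideal_perp[OF assms(1)] dual_of_quotient_submodule_def
      socle_annihilator_eq_max_ideal_apolar_perp[OF assms(1)]
  proof (intro conjI allI)
    show "module_isomorphic mpoly_ring
        (quot_module (quotient_by I) ((\<lambda>r. I +>\<^bsub>mpoly_ring\<^esub> r) ` max_ideal)) (quotient_by max_ideal)"
      using R.quotient_quotient_isomorphic[OF ideal_submodule_regular[OF I]
          ideal_submodule_regular[OF max_ideal_ideal] Im]
      by (simp add: quotient_by_def)
  qed (rule max_ideal_apolar_perp_submodule refl red_quot reduced_submodules_Gamma
      module_isomorphic_refl reduced_quotients_quotient_by[OF I Im nil] S red_soc | assumption)+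
qed

end
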